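(* Let $d\in\{2,3\}$. For every viscosity $\nu>0$, every resistivity $\eta>0$ and all constants $T>0$ and $M>0$, there exist a divergence-free vector field $b_0:\mathbb{T}^d\to\mathbb{R}^d$ with $\|b_0\|_{L^2(\mathbb{T}^d)}=M$ and a unique global smooth zero-average solution $(u,b)$ of the Magnetohydrodynamics system on $\mathbb{T}^d$ with viscosity $\nu$, resistivity $\eta$ and initial datum $(u,b)(0,\cdot)=(0,b_0)$, such that the magnetic lines at time $t=0$ and at time $t=T$ are not topologically equivalent, that is, there is no homeomorphism of $\mathbb{T}^d$ into itself mapping the magnetic lines of $b(0,\cdot)$ into those of $b(T,\cdot)$.
   Context: $\mathbb{T}^d=\mathbb{R}^d/(2\pi\mathbb{Z})^d$ is the $d$-dimensional flat torus. The Magnetohydrodynamics (MHD) system with viscosity $\nu$, resistivity $\eta$ and initial datum $(u_0,b_0)$ is $$\begin{cases}\partial_t u+(u\cdot\nabla)u+\nabla P=\nu\Delta u+(b\cdot\nabla)b,\\ \partial_t b+(u\cdot\nabla)b=(b\cdot\nabla)u+\eta\Delta b,\\ \operatorname{div}u=\operatorname{div}b=0,\\ u(0,\cdot)=u_0,\quad b(0,\cdot)=b_0,\end{cases}$$ where $u,b$ take values in $\mathbb{R}^d$ (velocity and magnetic field) and $P$ is a scalar pressure, which is also an unknown. "Global" means defined for all $t\ge 0$. "Zero-average" means $\int_{\mathbb{T}^d}u(t,x)\,dx=\int_{\mathbb{T}^d}b(t,x)\,dx=0$ for all $t$. The magnetic lines of $b(t,\cdot)$ ($t$ fixed) are the integral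 lines (images of the maximal trajectories) of the vector field $x\mapsto b(t,x)$ on $\mathbb{T}^d$. A homeomorphism maps the magnetic lines of one field into those of another if the image of each magnetic line of the first is a magnetic line of the second. *)

theory Defs
  imports "HOL-Analysis.Analysis"
begin

section \<open>The flat torus\<close>

definition torus_rel :: "real ^ 'n \<Rightarrow> real ^ 'n \<Rightarrow> bool" where
  "torus_rel x y \<longleftrightarrow> (\<forall>i. \<exists>k::int. x $ i = y $ i + 2 * pi * of_int k)"

lemma equivp_torus_rel: "equivp torus_rel"
proof (rule equivpI)
  show "reflp torus_rel"
    by (auto simp: reflp_def torus_rel_def intro: exI[of _ 0])
  show "symp torus_rel"
  proof (rule sympI)
    fix x y :: "real ^ 'n"
    assume xy: "torus_rel x y"
    show "torus_rel y x"
      unfolding torus_rel_def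
    proof
      fix i
      from xy obtain k :: int where "x $ i = y $ i + 2 * pi * of_int k"
        unfolding torus_rel_def by blast
      then have "y $ i = x $ i + 2 * pi * of_int (- k)" by simp
      then show "\<exists>k::int. y $ i = x $ i + 2 * pi * of_int k" ..
    qed
  qed
  show "transp torus_rel"
  proof (rule transpI)
    fix x y z :: "real ^ 'n"
    assume xy: "torus_rel x y" and yz: "torus_rel y z"
    show "torus_rel x z"
      unfolding torus_rel_def
    proof
      fix i
      from xy obtain k :: int where "x $ i = y $ i + 2 * pi * of_int k"
        unfolding torus_rel_def by blast
      moreover from yz obtain l :: int where "y $ i = z $ i + 2 * pi * of_int l"
        unfolding torus_rel_def by blast
      ultimately have "x $ i = z $ i + 2 * pi * of_int (l + k)"
        by (simp add: algebra_simps)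
      then show "\<exists>k::int. x $ i = z $ i + 2 * pi * of_int k" ..
    qed
  qed
qed

quotient_type 'n torus = "real ^ ('n::finite)" / torus_rel
  morphisms rep_torus to_torus
  by (rule equivp_torus_rel)

instantiation torus :: (finite) topological_space
begin

definition open_torus :: "'a torus set \<Rightarrow> bool" where
  "open_torus U \<longleftrightarrow> open (to_torus -` U)"

instance
proof
  show "open (UNIV :: 'a torus set)"
    by (simp add: open_torus_def)
  show "open (S \<inter> T)" if "open S" "open T" for S T :: "'a torus set"
    using that by (simp add: open_torus_def open_Int)
  show "open (\<Union>K)" if "\<forall>S\<in>K. open S" for K :: "'a torus set set"
    using that by (auto simp: open_torus_def vimage_Union)
qed

end

lift_definition translate :: "'n::finite torus \<Rightarrow> real ^ 'n \<Rightarrow> 'n torus" is "\<lambda>x v. x + v"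
  by (auto simp: torus_rel_def algebra_simps)

text \<open>Lebesgue measure of total mass \<open>(2\<pi>)\<^sup>d\<close>, transported from the
  fundamental domain; the identified faces of the closed cube are null sets.\<close>

definition torus_measure :: "'n::finite torus measure" where
  "torus_measure = distr (restrict_space lborel (cbox 0 (\<chi> i. 2 * pi))) borel to_torus"

definition L2_norm_torus :: "('n::finite torus \<Rightarrow> real ^ 'n) \<Rightarrow> real" where
  "L2_norm_torus v = sqrt (\<integral>p. (norm (v p))\<^sup>2 \<partial>torus_measure)"


section \<open>Smoothness and differential operators\<close>

text \<open>Derivatives are taken within \<open>S\<close>, hence one-sided at boundary points. This is used for
  convex \<open>S\<close> with non-empty interior, where the derivative within \<open>S\<close> is unique.\<close>

primrec Ck_on :: "nat \<Rightarrow> ('a::euclidean_space \<Rightarrow> 'b::real_normed_vector) \<Rightarrow> 'a set \<Rightarrow> bool" where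
  "Ck_on 0 f S \<longleftrightarrow> continuous_on S f"
| "Ck_on (Suc k) f S \<longleftrightarrow>
     (\<exists>f'. (\<forall>x\<in>S. (f has_derivative f' x) (at x within S)) \<and> (\<forall>v. Ck_on k (\<lambda>x. f' x v) S))"

definition smooth_on :: "('a::euclidean_space \<Rightarrow> 'b::real_normed_vector) \<Rightarrow> 'a set \<Rightarrow> bool" where
  "smooth_on f S \<longleftrightarrow> (\<forall>k. Ck_on k f S)"

text \<open>Time-dependent fields have type \<open>real \<Rightarrow> 'n torus \<Rightarrow> 'b\<close>; only their values
  at times \<open>t \<ge> 0\<close> are meaningful. They are smooth jointly in time and space, up to \<open>t = 0\<close>.\<close>

definition global_smooth :: "(real \<Rightarrow> 'n::finite torus \<Rightarrow> 'b::real_normed_vector) \<Rightarrow> bool" where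
  "global_smooth f \<longleftrightarrow> smooth_on (\<lambda>(t, x). f t (to_torus x)) ({0..} \<times> UNIV)"

definition time_deriv :: "(real \<Rightarrow> 'n::finite torus \<Rightarrow> 'b::real_normed_vector) \<Rightarrow> real \<Rightarrow> 'n torus \<Rightarrow> 'b" where
  "time_deriv f t p = vector_derivative (\<lambda>s. f s p) (at t within {0..})"

definition partial :: "'n::finite \<Rightarrow> ('n torus \<Rightarrow> 'b::real_normed_vector) \<Rightarrow> 'n torus \<Rightarrow> 'b" where
  "partial i f p = vector_derivative (\<lambda>s. f (translate p (s *\<^sub>R axis i 1))) (at 0)"

definition gradient :: "('n::finite torus \<Rightarrow> real) \<Rightarrow> 'n torus \<Rightarrow> real ^ 'n" where
  "gradient f p = (\<chi> i. partial i f p)"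

definition divergence :: "('n::finite torus \<Rightarrow> real ^ 'n) \<Rightarrow> 'n torus \<Rightarrow> real" where
  "divergence v p = (\<Sum>i\<in>UNIV. partial i (\<lambda>q. v q $ i) p)"

definition laplacian :: "('n::finite torus \<Rightarrow> 'b::real_normed_vector) \<Rightarrow> 'n torus \<Rightarrow> 'b" where
  "laplacian f p = (\<Sum>i\<in>UNIV. partial i (partial i f) p)"

text \<open>\<open>advect v w\<close> is \<open>(v \<cdot> \<nabla>) w\<close>.\<close>

definition advect ::
  "('n::finite torus \<Rightarrow> real ^ 'n) \<Rightarrow> ('n torus \<Rightarrow> 'b::real_normed_vector) \<Rightarrow> 'n torus \<Rightarrow> 'b" where
  "advect v w p = (\<Sum>i\<in>UNIV. (v p $ i) *\<^sub>R partial i w p)"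

definition divergence_free :: "('n::finite torus \<Rightarrow> real ^ 'n) \<Rightarrow> bool" where
  "divergence_free v \<longleftrightarrow>
     (\<lambda>x. v (to_torus x)) differentiable_on UNIV \<and> (\<forall>p. divergence v p = 0)"


section \<open>The MHD system\<close>

definition MHD_global_smooth_solution ::
  "real \<Rightarrow> real \<Rightarrow> ('n::finite torus \<Rightarrow> real ^ 'n) \<Rightarrow> ('n torus \<Rightarrow> real ^ 'n) \<Rightarrow>
   (real \<Rightarrow> 'n torus \<Rightarrow> real ^ 'n) \<Rightarrow> (real \<Rightarrow> 'n torus \<Rightarrow> real ^ 'n) \<Rightarrow> bool" where
  "MHD_global_smooth_solution \<nu> \<eta> u0 b0 u b \<longleftrightarrow>
     global_smooth u \<and> global_smooth b \<and>
     (\<exists>P :: real \<Rightarrow> 'n torus \<Rightarrow> real. global_smooth P \<and>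
       (\<forall>t\<ge>0. \<forall>p. time_deriv u t p + advect (u t) (u t) p + gradient (P t) p
                    = \<nu> *\<^sub>R laplacian (u t) p + advect (b t) (b t) p)) \<and>
     (\<forall>t\<ge>0. \<forall>p. time_deriv b t p + advect (u t) (b t) p
                    = advect (b t) (u t) p + \<eta> *\<^sub>R laplacian (b t) p) \<and>
     (\<forall>t\<ge>0. divergence_free (u t) \<and> divergence_free (b t)) \<and>
     u 0 = u0 \<and> b 0 = b0"

definition zero_average :: "(real \<Rightarrow> 'n::finite torus \<Rightarrow> real ^ 'n) \<Rightarrow> bool" where
  "zero_average v \<longleftrightarrow> (\<forall>t\<ge>0. (\<integral>p. v t p \<partial>torus_measure) = 0)"


section \<open>Integral lines and topological equivalence\<close>

text \<open>The velocity of a curve in the torus is that of a lift to the universal cover.\<close>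

definition integral_curve ::
  "('n::finite torus \<Rightarrow> real ^ 'n) \<Rightarrow> real set \<Rightarrow> (real \<Rightarrow> 'n torus) \<Rightarrow> bool" where
  "integral_curve v I \<gamma> \<longleftrightarrow>
     open I \<and> is_interval I \<and> I \<noteq> {} \<and>
     (\<exists>g. \<forall>s\<in>I. \<gamma> s = to_torus (g s) \<and> (g has_vector_derivative v (\<gamma> s)) (at s))"

definition maximal_integral_curve ::
  "('n::finite torus \<Rightarrow> real ^ 'n) \<Rightarrow> real set \<Rightarrow> (real \<Rightarrow> 'n torus) \<Rightarrow> bool" where
  "maximal_integral_curve v I \<gamma> \<longleftrightarrow>
     integral_curve v I \<gamma> \<and>
     (\<forall>J \<delta>. integral_curve v J \<delta> \<and> I \<subseteq> J \<and> (\<forall>s\<in>I. \<delta> s = \<gamma> s) \<longrightarrow> J = I)"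

definition integral_lines :: "('n::finite torus \<Rightarrow> real ^ 'n) \<Rightarrow> 'n torus set set" where
  "integral_lines v = {\<gamma> ` I | \<gamma> I. maximal_integral_curve v I \<gamma>}"

definition topologically_equivalent ::
  "('n::finite torus \<Rightarrow> real ^ 'n) \<Rightarrow> ('n torus \<Rightarrow> real ^ 'n) \<Rightarrow> bool" where
  "topologically_equivalent v w \<longleftrightarrow>
     (\<exists>h k. homeomorphism UNIV UNIV h k \<and> (\<forall>L\<in>integral_lines v. h ` L \<in> integral_lines w))"

end

theory Submission
  imports Defs
begin

text \<open>A shear field \<open>b(t, x) = f(t, x\<^sub>j) e\<^sub>i\<close> with \<open>i \<noteq> j\<close> is divergence-free and satisfies
  \<open>(b \<cdot> \<nabla>) b = 0\<close>, so \<open>u = 0\<close>, \<open>P = 0\<close> and \<open>b\<close> solve the MHD system as soon as \<open>f\<close> solves the heat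
  equation. For \<open>f(t, y) = A (e\<^bsup>-\<eta>t\<^esup> sin y + (2q)\<^sup>-\<^sup>1 e\<^bsup>-4\<eta>t\<^esup> sin 2y)\<close> with \<open>q = e\<^bsup>-3\<eta>T/2\<^esup>\<close> the magnetic field
  vanishes at time \<open>0\<close> where \<open>sin x\<^sub>j = 0\<close> or \<open>cos x\<^sub>j = -q\<close>, but at time \<open>T\<close> only where
  \<open>sin x\<^sub>j = 0\<close>, because the second mode decays faster. A homeomorphism that maps magnetic lines to
  magnetic lines maps the first zero set onto the second, which has fewer components.
  Uniqueness is the \<open>L\<^sup>2\<close> energy estimate for the difference of two solutions with Gronwall's
  inequality.\<close>

section \<open>Functions on the torus\<close>

lemma translate_to_torus [simp]: "translate (to_torus x) v = to_torus (x + v)"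
  by (simp add: translate.abs_eq)

lemma translate_zero [simp]: "translate p 0 = p"
  by transfer (auto simp: torus_rel_def intro: exI[of _ 0])

lemma to_torus_eq_iff: "to_torus x = to_torus y \<longleftrightarrow> torus_rel x y"
  by (rule torus.abs_eq_iff)

lemma to_torus_rep [simp]: "to_torus (rep_torus p) = p"
  by (rule Quotient3_abs_rep[OF Quotient3_torus])

lemma torus_cases [case_names to_torus]: obtains x where "p = to_torus x"
  by (metis to_torus_rep)

text \<open>The torus carries the quotient topology, so openness of preimages is tested after
  pulling back along \<open>to_torus\<close>.\<close>

lemma continuous_on_torus_iff:
  fixes f :: "'n::finite torus \<Rightarrow> 'b::topological_space"
  shows "continuous_on UNIV f \<longleftrightarrow> continuous_on UNIV (\<lambda>x. f (to_torus x))"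
  by (simp add: continuous_on_open_vimage open_torus_def vimage_def)

lemma continuous_on_to_torus: "continuous_on S to_torus"
  by (rule continuous_on_subset[of UNIV])
     (auto simp: continuous_on_open_vimage open_torus_def)

abbreviation torus_cube :: "(real ^ 'n::finite) set" where
  "torus_cube \<equiv> cbox 0 (\<chi> i. 2 * pi)"

text \<open>Lets facts proved on the closed fundamental cube, such as the vanishing of an energy
  density, pass to every point of the torus.\<close>

lemma to_torus_cube:
  obtains x where "x \<in> torus_cube" "p = to_torus x"
proof -
  define y where "y = rep_torus p"
  define k where "k i = \<lfloor>y $ i / (2 * pi)\<rfloor>" for i
  define x where "x = (\<chi> i. y $ i - 2 * pi * of_int (k i))"
  have "0 \<le> x $ i \<and> x $ i \<le> 2 * pi" for i
  proof -
    have "of_int (k i) \<le> y $ i / (2 * pi)" "y $ i / (2 * pi) \<le> of_int (k i) + 1"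
      unfolding k_def by linarith+
    then show ?thesis by (simp add: x_def field_simps)
  qed
  then have "x \<in> torus_cube" by (simp add: mem_box_cart)
  moreover have "torus_rel y x"
    unfolding torus_rel_def x_def by (auto intro!: exI[of _ "k _"])
  then have "p = to_torus x"
    by (simp add: y_def flip: to_torus_eq_iff)
  ultimately show ?thesis using that by blast
qed

text \<open>Relational form of \<open>partial\<close>: it asserts that the derivative exists, so
  derivative rules can be chained, whereas \<open>vector_derivative\<close> alone carries no such
  information.\<close>

definition has_partial ::
  "'n::finite \<Rightarrow> ('n torus \<Rightarrow> 'b::real_normed_vector) \<Rightarrow> 'b \<Rightarrow> 'n torus \<Rightarrow> bool" where
  "has_partial i f D p \<longleftrightarrow>
     ((\<lambda>s. f (translate p (s *\<^sub>R axis i 1))) has_vector_derivative D) (at 0)"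

lemma partial_eqI: "has_partial i f D p \<Longrightarrow> partial i f p = D"
  unfolding has_partial_def partial_def by (rule vector_derivative_at)

lemma has_partial_const: "has_partial i (\<lambda>_. c) 0 p"
  unfolding has_partial_def by simp

lemma has_partial_add:
  "has_partial i f D p \<Longrightarrow> has_partial i g E p \<Longrightarrow> has_partial i (\<lambda>q. f q + g q) (D + E) p"
  unfolding has_partial_def by (rule has_vector_derivative_add)

lemma has_partial_diff:
  "has_partial i f D p \<Longrightarrow> has_partial i g E p \<Longrightarrow> has_partial i (\<lambda>q. f q - g q) (D - E) p"
  unfolding has_partial_def by (rule has_vector_derivative_diff)

lemma has_partial_bounded_linear:
  "bounded_linear T \<Longrightarrow> has_partial i f D p \<Longrightarrow> has_partial i (\<lambda>q. T (f q)) (T D) p"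
  unfolding has_partial_def by (rule bounded_linear.has_vector_derivative)

lemmas has_partial_nth = has_partial_bounded_linear[OF bounded_linear_vec_nth]

lemma has_partial_bilinear:
  assumes "bounded_bilinear B" "has_partial i f D p" "has_partial i g E p"
  shows "has_partial i (\<lambda>q. B (f q) (g q)) (B (f p) E + B D (g p)) p"
  using bounded_bilinear.has_vector_derivative[OF assms(1) assms(2,3)[unfolded has_partial_def]]
  unfolding has_partial_def by simp

lemmas has_partial_mult = has_partial_bilinear[OF bounded_bilinear_mult]
lemmas has_partial_inner = has_partial_bilinear[OF bounded_bilinear_inner]

text \<open>The derivative at parameter 0 is known at every base point, and moving the base point
  along the axis turns it into the derivative at any parameter \<open>s\<close>.\<close>

lemma has_partial_along:
  assumes "\<And>p. has_partial i f (g p) p"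
  shows "((\<lambda>s. f (to_torus (x + s *\<^sub>R axis i 1))) has_vector_derivative
           g (to_torus (x + s *\<^sub>R axis i 1))) (at s within S)"
proof -
  let ?F = "\<lambda>h. f (to_torus ((x + s *\<^sub>R axis i 1) + h *\<^sub>R axis i 1))"
  have "(?F has_vector_derivative g (to_torus (x + s *\<^sub>R axis i 1))) (at 0)"
    using assms[of "to_torus (x + s *\<^sub>R axis i 1)"] by (simp add: has_partial_def)
  then have "((?F \<circ> (\<lambda>r. r - s)) has_vector_derivative 1 *\<^sub>R g (to_torus (x + s *\<^sub>R axis i 1))) (at s)"
    by (intro vector_diff_chain_at) (auto intro!: derivative_eq_intros)
  then have "((?F \<circ> (\<lambda>r. r - s)) has_vector_derivative g (to_torus (x + s *\<^sub>R axis i 1))) (at s)"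
    by simp
  moreover have "?F \<circ> (\<lambda>r. r - s) = (\<lambda>r. f (to_torus (x + r *\<^sub>R axis i 1)))"
    by (auto simp: fun_eq_iff algebra_simps)
  ultimately show ?thesis
    by (auto intro: has_vector_derivative_at_within)
qed

text \<open>Passes from the push-forward measure to a gauge integral over a box, where box splitting
  and the Leibniz rule are available.\<close>

lemma integral_torus:
  fixes f :: "'n::finite torus \<Rightarrow> 'b::euclidean_space"
  assumes "continuous_on UNIV (\<lambda>x. f (to_torus x))"
  shows "(\<integral>p. f p \<partial>torus_measure) = integral torus_cube (\<lambda>x. f (to_torus x))"
proof -
  have m1: "to_torus \<in> borel_measurable (restrict_space lborel (torus_cube :: (real^'n) set))"
    using borel_measurable_continuous_onI[OF continuous_on_to_torus]
    by (auto intro!: measurable_restrict_space1)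
  have m2: "f \<in> borel_measurable borel"
    using assms by (intro borel_measurable_continuous_onI) (simp add: continuous_on_torus_iff)
  have "(\<integral>p. f p \<partial>torus_measure) = (\<integral>x. f (to_torus x) \<partial>restrict_space lborel torus_cube)"
    unfolding torus_measure_def by (rule integral_distr[OF m1 m2])
  also have "\<dots> = set_lebesgue_integral lborel torus_cube (\<lambda>x. f (to_torus x))"
    unfolding set_lebesgue_integral_def by (rule integral_restrict_space) simp
  also have "\<dots> = integral torus_cube (\<lambda>x. f (to_torus x))"
    by (rule set_borel_integral_eq_integral(2))
       (auto intro!: borel_integrable_compact simp: set_integrable_def
         continuous_on_subset[OF assms])
  finally show ?thesis .
qed

text \<open>The integral over the box swept out by the moving cube is split in two ways.\<close>

lemma integral_cube_translate:
  fixes f :: "'n::finite torus \<Rightarrow> 'b::euclidean_space"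
  assumes cont: "continuous_on UNIV (\<lambda>x. f (to_torus x))" and s: "0 \<le> s" "s \<le> 2 * pi"
  shows "integral torus_cube (\<lambda>x. f (to_torus (x + s *\<^sub>R axis i 1)))
       = integral torus_cube (\<lambda>x. f (to_torus x))"
proof -
  let ?F = "\<lambda>x. f (to_torus x)"
  let ?e = "axis i 1 :: real^'n"
  define c :: "real^'n" where "c = (\<chi> k. 2 * pi)"
  have int: "?F integrable_on cbox a b" for a b
    by (rule integrable_continuous) (rule continuous_on_subset[OF cont], simp)
  have shift: "integral (cbox a b) (\<lambda>x. ?F (x + v)) = integral (cbox (a + v) (b + v)) ?F" for a b v
    using integral_shift_cbox_plus[of a b ?F v] by (simp add: o_def add.commute)
  have e: "?e \<in> Basis" by (simp add: axis_in_Basis_iff)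
  have split: "integral (cbox 0 (c + s *\<^sub>R ?e)) ?F
     = integral (cbox 0 (c + s *\<^sub>R ?e) \<inter> {x. x \<bullet> ?e \<le> r}) ?F
     + integral (cbox 0 (c + s *\<^sub>R ?e) \<inter> {x. r \<le> x \<bullet> ?e}) ?F" for r
    using integral_split[OF int e] by simp
  have lower: "cbox 0 (c + s *\<^sub>R ?e) \<inter> {x. x \<bullet> ?e \<le> r} = cbox 0 (c + (r - 2 * pi) *\<^sub>R ?e)"
    and upper: "cbox 0 (c + s *\<^sub>R ?e) \<inter> {x. r \<le> x \<bullet> ?e} = cbox (r *\<^sub>R ?e) (c + s *\<^sub>R ?e)"
    if r: "0 \<le> r" "r \<le> 2 * pi + s" for r
  proof -
    have "x \<in> cbox 0 (c + s *\<^sub>R ?e) \<inter> {x. x \<bullet> ?e \<le> r} \<longleftrightarrow>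
        (\<forall>k. 0 \<le> x $ k \<and> x $ k \<le> (c + s *\<^sub>R ?e) $ k \<and> (k = i \<longrightarrow> x $ k \<le> r))" for x
      by (auto simp: mem_box_cart inner_axis)
    also have "\<dots> x \<longleftrightarrow> x \<in> cbox 0 (c + (r - 2 * pi) *\<^sub>R ?e)" for x
      unfolding mem_box_cart by (intro all_cong1) (use r in \<open>auto simp: c_def axis_def\<close>)
    finally show "cbox 0 (c + s *\<^sub>R ?e) \<inter> {x. x \<bullet> ?e \<le> r} = cbox 0 (c + (r - 2 * pi) *\<^sub>R ?e)"
      by blast
    have "x \<in> cbox 0 (c + s *\<^sub>R ?e) \<inter> {x. r \<le> x \<bullet> ?e} \<longleftrightarrow>
        (\<forall>k. 0 \<le> x $ k \<and> x $ k \<le> (c + s *\<^sub>R ?e) $ k \<and> (k = i \<longrightarrow> r \<le> x $ k))" for x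
      by (auto simp: mem_box_cart inner_axis)
    also have "\<dots> x \<longleftrightarrow> x \<in> cbox (r *\<^sub>R ?e) (c + s *\<^sub>R ?e)" for x
      unfolding mem_box_cart by (intro all_cong1) (use r in \<open>auto simp: c_def axis_def\<close>)
    finally show "cbox 0 (c + s *\<^sub>R ?e) \<inter> {x. r \<le> x \<bullet> ?e} = cbox (r *\<^sub>R ?e) (c + s *\<^sub>R ?e)"
      by blast
  qed
  have per: "to_torus (x + (2 * pi) *\<^sub>R ?e) = to_torus x" for x
    by (auto simp: to_torus_eq_iff torus_rel_def axis_def intro: exI[of _ 0] exI[of _ 1])
  have a: "c + (s - 2 * pi) *\<^sub>R ?e + (2 * pi) *\<^sub>R ?e = c + s *\<^sub>R ?e"
    by (simp add: algebra_simps)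
  \<comment> \<open>Cut at \<open>2 * pi\<close>: by periodicity the piece beyond the cube has the
    same integral as the slab of width \<open>s\<close> at the origin.\<close>
  have "integral (cbox 0 (c + s *\<^sub>R ?e)) ?F
      = integral (cbox 0 c) ?F + integral (cbox 0 (c + (s - 2 * pi) *\<^sub>R ?e)) ?F"
    using split[of "2 * pi"] lower[of "2 * pi"] upper[of "2 * pi"] s
      shift[of 0 "c + (s - 2 * pi) *\<^sub>R ?e" "(2 * pi) *\<^sub>R ?e", unfolded per a]
    by simp
  \<comment> \<open>Cut at \<open>s\<close>: the lower piece is that same slab and the upper piece
    is the translated cube, so the slab cancels.\<close>
  moreover have "integral (cbox 0 (c + s *\<^sub>R ?e)) ?F
      = integral (cbox 0 (c + (s - 2 * pi) *\<^sub>R ?e)) ?F + integral (cbox 0 c) (\<lambda>x. ?F (x + s *\<^sub>R ?e))"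
    using split[of s] lower[of s] upper[of s] s shift[of 0 c "s *\<^sub>R ?e"] by simp
  ultimately show ?thesis by (simp add: c_def)
qed

text \<open>The integral of the shifted \<open>f\<close> does not depend on the shift;
  differentiating it under the integral sign at shift 0 gives the integral of \<open>g\<close>. This
  replaces integration by parts in the energy estimate.\<close>

lemma integral_partial_eq_0:
  fixes f g :: "'n::finite torus \<Rightarrow> 'b::euclidean_space"
  assumes der: "\<And>p. has_partial i f (g p) p"
    and f: "continuous_on UNIV (\<lambda>x. f (to_torus x))"
    and g: "continuous_on UNIV (\<lambda>x. g (to_torus x))"
  shows "integral torus_cube (\<lambda>x. g (to_torus x)) = 0"
proof -
  let ?e = "axis i 1 :: real^'n"
  let ?I = "\<lambda>s. integral torus_cube (\<lambda>x. f (to_torus (x + s *\<^sub>R ?e)))"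
  have D: "(?I has_vector_derivative integral torus_cube (\<lambda>x. g (to_torus (x + 0 *\<^sub>R ?e))))
          (at 0 within {0..2 * pi})"
  proof (rule leibniz_rule_vector_derivative)
    show "((\<lambda>s. f (to_torus (x + s *\<^sub>R ?e))) has_vector_derivative g (to_torus (x + s *\<^sub>R ?e)))
            (at s within {0..2 * pi})" for s x
      using der by (rule has_partial_along)
    show "(\<lambda>x. f (to_torus (x + s *\<^sub>R ?e))) integrable_on torus_cube" for s
      by (intro integrable_continuous continuous_on_compose2[OF f] continuous_intros) auto
    show "continuous_on ({0..2 * pi} \<times> torus_cube) (\<lambda>(s, x). g (to_torus (x + s *\<^sub>R ?e)))"
      unfolding case_prod_unfold
      by (intro continuous_on_compose2[OF g] continuous_intros) auto
  qed auto
  have D0: "(?I has_vector_derivative 0) (at 0 within {0..2 * pi})"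
    by (rule has_vector_derivative_transform[where f = "\<lambda>_. ?I 0"])
       (auto simp: integral_cube_translate[OF f])
  have "at 0 within {0..2 * pi} \<noteq> bot"
    by (simp add: at_within_Icc_at_right)
  from vector_derivative_unique_within[OF this D D0] show ?thesis by simp
qed

section \<open>Smooth time-dependent fields\<close>

lemma Ck_on_cong: "Ck_on k f S \<Longrightarrow> (\<And>x. x \<in> S \<Longrightarrow> f x = g x) \<Longrightarrow> Ck_on k g S"
proof (cases k)
  case 0
  assume "Ck_on k f S" "\<And>x. x \<in> S \<Longrightarrow> f x = g x"
  with 0 show ?thesis by (auto cong: continuous_on_cong_simp)
next
  case (Suc m)
  assume f: "Ck_on k f S" and eq: "\<And>x. x \<in> S \<Longrightarrow> f x = g x"
  then obtain f' where "\<forall>x\<in>S. (f has_derivative f' x) (at x within S)"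
      and "\<forall>v. Ck_on m (\<lambda>x. f' x v) S"
    using Suc by auto
  moreover have "(g has_derivative f' x) (at x within S)" if "x \<in> S" for x
    using calculation(1) eq that by (auto intro: has_derivative_transform[of _ _ g f])
  ultimately show ?thesis using Suc by auto
qed

lemma Ck_on_add: "Ck_on k f S \<Longrightarrow> Ck_on k g S \<Longrightarrow> Ck_on k (\<lambda>x. f x + g x) S"
proof (induction k arbitrary: f g)
  case 0
  then show ?case by (auto intro: continuous_intros)
next
  case (Suc k)
  from Suc.prems obtain f' g'
    where "\<forall>x\<in>S. (f has_derivative f' x) (at x within S)" "\<forall>v. Ck_on k (\<lambda>x. f' x v) S"
      "\<forall>x\<in>S. (g has_derivative g' x) (at x within S)" "\<forall>v. Ck_on k (\<lambda>x. g' x v) S"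
    by auto
  then show ?case
    by (auto intro!: exI[of _ "\<lambda>x v. f' x v + g' x v"] has_derivative_add Suc.IH)
qed

lemma Ck_on_bounded_linear: "bounded_linear T \<Longrightarrow> Ck_on k f S \<Longrightarrow> Ck_on k (\<lambda>x. T (f x)) S"
proof (induction k arbitrary: f)
  case 0
  then show ?case by (auto intro: bounded_linear.continuous_on)
next
  case (Suc k)
  from Suc.prems obtain f'
    where "\<forall>x\<in>S. (f has_derivative f' x) (at x within S)" "\<forall>v. Ck_on k (\<lambda>x. f' x v) S"
    by auto
  then show ?case
    using Suc by (auto intro!: exI[of _ "\<lambda>x v. T (f' x v)"] bounded_linear.has_derivative[OF Suc.prems(1)])
qed

lemma Ck_on_const: "Ck_on k (\<lambda>_. c) S"
  by (induction k arbitrary: c) (auto intro!: exI[of _ "\<lambda>_ _. 0"])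

context
  fixes f :: "real \<Rightarrow> 'n::finite torus \<Rightarrow> 'b::real_normed_vector"
  assumes f: "global_smooth f"
begin

lemma global_smooth_continuous_on:
  "continuous_on ({0..} \<times> UNIV) (\<lambda>(t, x). f t (to_torus x))"
  using f by (auto simp: global_smooth_def smooth_on_def dest: spec[of _ 0])

lemma global_smooth_continuous_slice:
  assumes "t \<ge> 0"
  shows "continuous_on S (\<lambda>x. f t (to_torus x))"
proof -
  have "continuous_on S (\<lambda>x. (\<lambda>(t, x). f t (to_torus x)) (t, x))"
    using assms by (intro continuous_on_compose2[OF global_smooth_continuous_on] continuous_intros) auto
  then show ?thesis by simp
qed

text \<open>Chain rule along the curves \<open>(t, x + s e_i)\<close> and \<open>(s, x)\<close>,
  which stay in the half-space of nonnegative times. The spatial derivative is therefore two-sided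
  even at \<open>t = 0\<close>, the time derivative one-sided there.\<close>

lemma global_smooth_derivatives:
  assumes D: "\<forall>z\<in>{0..}\<times>UNIV. ((\<lambda>(t, x). f t (to_torus x)) has_derivative D z) (at z within {0..}\<times>UNIV)"
    and t: "t \<ge> 0"
  shows "has_partial i (f t) (D (t, x) (0, axis i 1)) (to_torus x)"
    and "((\<lambda>s. f s (to_torus x)) has_vector_derivative D (t, x) (1, 0)) (at t within {0..})"
proof -
  let ?F = "\<lambda>(t, x). f t (to_torus x)"
  let ?S = "{0::real..} \<times> (UNIV :: (real^'n) set)"
  have lin: "bounded_linear (D (t, x))"
    using D t by (auto intro: has_derivative_bounded_linear)
  have scale: "D (t, x) (r *\<^sub>R z) = r *\<^sub>R D (t, x) z" for r z
    using lin by (simp add: linear_simps)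
  have "((\<lambda>s. (t, x + s *\<^sub>R axis i 1)) has_derivative (\<lambda>s. (0, s *\<^sub>R axis i 1))) (at 0)"
    by (auto intro!: derivative_eq_intros)
  then have "((\<lambda>s. ?F (t, x + s *\<^sub>R axis i 1)) has_derivative (\<lambda>s. D (t, x) (0, s *\<^sub>R axis i 1))) (at 0)"
    using has_derivative_in_compose2[of ?S ?F D "\<lambda>s. (t, x + s *\<^sub>R axis i 1)" UNIV 0] D t
    by (auto simp: image_subset_iff)
  then have "((\<lambda>s. ?F (t, x + s *\<^sub>R axis i 1)) has_derivative (\<lambda>s. s *\<^sub>R D (t, x) (0, axis i 1))) (at 0)"
    using scale[of _ "(0, axis i 1)"] by simp
  then show "has_partial i (f t) (D (t, x) (0, axis i 1)) (to_torus x)"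
    by (simp add: has_partial_def has_vector_derivative_def)
  have "((\<lambda>s. (s, x)) has_derivative (\<lambda>s. (s, 0))) (at t within {0..})"
    by (auto intro!: derivative_eq_intros)
  then have time: "((\<lambda>s. ?F (s, x)) has_derivative (\<lambda>s. D (t, x) (s, 0))) (at t within {0..})"
    using has_derivative_in_compose2[of ?S ?F D "\<lambda>s. (s, x)" "{0..}" t] D t
    by (auto simp: image_subset_iff)
  have "D (t, x) (s, 0) = s *\<^sub>R D (t, x) (1, 0)" for s
    using scale[of s "(1, 0)"] by simp
  then have "((\<lambda>s. ?F (s, x)) has_derivative (\<lambda>s. s *\<^sub>R D (t, x) (1, 0))) (at t within {0..})"
    by (intro has_derivative_eq_rhs[OF time] ext)
  then show "((\<lambda>s. f s (to_torus x)) has_vector_derivative D (t, x) (1, 0)) (at t within {0..})"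
    by (simp add: has_vector_derivative_def)
qed

end

text \<open>Every \<open>t \<ge> 0\<close> is a limit of larger times, so the derivative within
  \<open>{0..}\<close> is unique, also at the boundary time 0.\<close>

lemma time_deriv_eqI:
  assumes "((\<lambda>s. f s p) has_vector_derivative D) (at t within {0..})" "t \<ge> 0"
  shows "time_deriv f t p = D"
proof -
  have "at_right t \<le> at t within {0..}"
    using assms(2) by (intro at_le) auto
  then have "at t within {0..} \<noteq> bot"
    using trivial_limit_at_right_real[of t] by (auto simp: bot_unique)
  then show ?thesis
    unfolding time_deriv_def using assms(1) by (rule vector_derivative_within)
qed

lemma
  assumes f: "global_smooth f" and t: "t \<ge> 0"
  shows global_smooth_has_partial: "has_partial i (f t) (partial i (f t) p) p"
    and global_smooth_has_time_deriv:
      "((\<lambda>s. f s p) has_vector_derivative time_deriv f t p) (at t within {0..})"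
proof -
  obtain x where p: "p = to_torus x" by (rule torus_cases)
  have "Ck_on (Suc 0) (\<lambda>(t, x). f t (to_torus x)) ({0..} \<times> UNIV)"
    using f unfolding global_smooth_def smooth_on_def by blast
  then obtain D where
    D: "\<forall>z\<in>{0..}\<times>UNIV. ((\<lambda>(t, x). f t (to_torus x)) has_derivative D z) (at z within {0..}\<times>UNIV)"
    by auto
  note * = global_smooth_derivatives[OF f D t, where x = x]
  show "has_partial i (f t) (partial i (f t) p) p"
    using *(1)[of i] partial_eqI[OF *(1)[of i]] by (simp add: p)
  have "time_deriv f t p = D (t, x) (1, 0)"
    unfolding p by (rule time_deriv_eqI) (use *(2) t in auto)
  then show "((\<lambda>s. f s p) has_vector_derivative time_deriv f t p) (at t within {0..})"
    using *(2) by (simp add: p)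
qed

text \<open>Both derivatives are values of the Frechet derivative in fixed directions, which
  \<open>Ck_on (Suc k)\<close> makes \<open>Ck_on k\<close>. The derivative \<open>D\<close> is
  chosen anew for each \<open>k\<close>, but uniqueness ties its values to \<open>partial\<close>
  and \<open>time_deriv\<close>.\<close>

lemma
  assumes f: "global_smooth f"
  shows global_smooth_partial: "global_smooth (\<lambda>t. partial i (f t))"
    and global_smooth_time_deriv: "global_smooth (time_deriv f)"
proof -
  have "Ck_on k (\<lambda>(t, x). partial i (f t) (to_torus x)) ({0..} \<times> UNIV) \<and>
        Ck_on k (\<lambda>(t, x). time_deriv f t (to_torus x)) ({0..} \<times> UNIV)" for k
  proof -
    have "Ck_on (Suc k) (\<lambda>(t, x). f t (to_torus x)) ({0..} \<times> UNIV)"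
      using f unfolding global_smooth_def smooth_on_def by blast
    then obtain D where
      D: "\<forall>z\<in>{0..}\<times>UNIV. ((\<lambda>(t, x). f t (to_torus x)) has_derivative D z) (at z within {0..}\<times>UNIV)"
      and k: "\<And>v. Ck_on k (\<lambda>z. D z v) ({0..} \<times> UNIV)"
      by auto
    have "time_deriv f t (to_torus x) = D (t, x) (1, 0)" if "t \<ge> 0" for t x
      by (rule time_deriv_eqI) (use global_smooth_derivatives(2)[OF f D] that in auto)
    then show ?thesis
      using partial_eqI[OF global_smooth_derivatives(1)[OF f D]]
      by (intro conjI; auto intro: Ck_on_cong[OF k[of "(0, axis i 1)"]] Ck_on_cong[OF k[of "(1, 0)"]])
  qed
  then show "global_smooth (\<lambda>t. partial i (f t))" "global_smooth (time_deriv f)"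
    by (auto simp: global_smooth_def smooth_on_def)
qed

section \<open>Uniqueness by the energy method\<close>

text \<open>Cauchy-Schwarz bound for the quadratic terms that no divergence absorbs:
  \<open>X\<close> is a derivative of the first solution, \<open>v\<close> and \<open>w\<close> are
  differences of velocities or magnetic fields.\<close>

lemma stretching_term_le:
  fixes v w X :: "real ^ 'n::finite"
  assumes "norm X \<le> K" "norm w \<le> r" "norm v \<le> r"
  shows "\<bar>v $ i * (w \<bullet> X)\<bar> \<le> K * r\<^sup>2"
proof -
  have K: "0 \<le> K" using assms(1) norm_ge_zero order_trans by blast
  have r: "0 \<le> r" using assms(2) norm_ge_zero order_trans by blast
  have "\<bar>v $ i\<bar> \<le> r"
    using component_le_norm_cart[of v i] assms(3) by linarith
  moreover have "\<bar>w \<bullet> X\<bar> \<le> r * K"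
    using Cauchy_Schwarz_ineq2[of w X] mult_mono[OF assms(2,1) r norm_ge_zero] by linarith
  ultimately have "\<bar>v $ i\<bar> * \<bar>w \<bullet> X\<bar> \<le> r * (r * K)"
    using r K by (intro mult_mono) auto
  then show ?thesis by (simp add: abs_mult power2_eq_square mult_ac)
qed

text \<open>Here \<open>U\<close>, \<open>B\<close>, \<open>UU\<close>, \<open>BB\<close>, \<open>G\<close> stand for the values at one point of \<open>\<partial>\<^sub>i u\<close>, \<open>\<partial>\<^sub>i b\<close>,
  \<open>\<partial>\<^sub>i\<^sup>2 u\<close>, \<open>\<partial>\<^sub>i\<^sup>2 b\<close>, \<open>\<nabla>P\<close>, and \<open>energy_flux_deriv i\<close> for that of the \<open>\<partial>\<^sub>i\<close>-derivative of the
  \<open>i\<close>-th component of the energy flux of the difference of two solutions,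
  \<open>\<nu> w \<bullet> \<partial>\<^sub>i w + \<eta> z \<bullet> \<partial>\<^sub>i z - u'\<^sub>i (|w|\<^sup>2 + |z|\<^sup>2) / 2 - (P' - P) w\<^sub>i + b'\<^sub>i (w \<bullet> z)\<close>
  with \<open>w = u' - u\<close> and \<open>z = b' - b\<close>.\<close>

definition energy_flux_deriv where
  "energy_flux_deriv \<nu> \<eta> u' b' w z W Z WW ZZ Udiag' Bdiag' \<pi> d\<pi> i =
     \<nu> * (w \<bullet> WW + W \<bullet> W) + \<eta> * (z \<bullet> ZZ + Z \<bullet> Z)
     - (u' $ i * (w \<bullet> W + z \<bullet> Z) + Udiag' * ((w \<bullet> w + z \<bullet> z) / 2))
     - (w $ i * d\<pi> + W $ i * \<pi>)
     + (b' $ i * (w \<bullet> Z + W \<bullet> z) + Bdiag' * (w \<bullet> z))"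
  for w z W Z WW ZZ u' b' :: "real ^ 'n::finite" and \<pi> d\<pi> Udiag' Bdiag' \<nu> \<eta> :: real

text \<open>With the second solution written as the first plus \<open>(w, z)\<close>, each term of
  the energy balance is part of the flux divergence, a dissipation of good sign, a multiple of a
  divergence, or a quadratic term containing a derivative of the first solution. The pressure
  difference enters only through the flux.\<close>

lemma energy_pointwise_le:
  fixes u b u' b' :: "real ^ 'n::finite" and U B UU BB U' B' UU' BB' :: "'n \<Rightarrow> real ^ 'n"
  assumes u: "ut + (\<Sum>i\<in>UNIV. u $ i *\<^sub>R U i) + G
      = \<nu> *\<^sub>R (\<Sum>i\<in>UNIV. UU i) + (\<Sum>i\<in>UNIV. b $ i *\<^sub>R B i)"
    and u': "ut' + (\<Sum>i\<in>UNIV. u' $ i *\<^sub>R U' i) + G'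
      = \<nu> *\<^sub>R (\<Sum>i\<in>UNIV. UU' i) + (\<Sum>i\<in>UNIV. b' $ i *\<^sub>R B' i)"
    and b: "bt + (\<Sum>i\<in>UNIV. u $ i *\<^sub>R B i)
      = (\<Sum>i\<in>UNIV. b $ i *\<^sub>R U i) + \<eta> *\<^sub>R (\<Sum>i\<in>UNIV. BB i)"
    and b': "bt' + (\<Sum>i\<in>UNIV. u' $ i *\<^sub>R B' i)
      = (\<Sum>i\<in>UNIV. b' $ i *\<^sub>R U' i) + \<eta> *\<^sub>R (\<Sum>i\<in>UNIV. BB' i)"
    and div: "(\<Sum>i\<in>UNIV. U i $ i) = 0" "(\<Sum>i\<in>UNIV. U' i $ i) = 0" "(\<Sum>i\<in>UNIV. B' i $ i) = 0"
    and K: "\<And>i. norm (U i) \<le> K" "\<And>i. norm (B i) \<le> K"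
    and \<nu>: "\<nu> \<ge> 0" and \<eta>: "\<eta> \<ge> 0"
  defines "w \<equiv> u' - u" and "z \<equiv> b' - b"
  shows "w \<bullet> (ut' - ut) + z \<bullet> (bt' - bt)
    \<le> (\<Sum>i\<in>UNIV. energy_flux_deriv \<nu> \<eta> u' b' w z (U' i - U i) (B' i - B i) (UU' i - UU i)
           (BB' i - BB i) (U' i $ i) (B' i $ i) \<pi> (G' $ i - G $ i) i)
      + real CARD('n) * (8 * K) * ((w \<bullet> w + z \<bullet> z) / 2)"
proof -
  define F where "F i = energy_flux_deriv \<nu> \<eta> u' b' w z (U' i - U i) (B' i - B i) (UU' i - UU i)
           (BB' i - BB i) (U' i $ i) (B' i $ i) \<pi> (G' $ i - G $ i) i" for i
  define W where "W i = U' i - U i" for i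
  define Z where "Z i = B' i - B i" for i
  define e where "e = (w \<bullet> w + z \<bullet> z) / 2"
  \<comment> \<open>The terms left over: each pairs two components of the difference with a
    derivative of the first solution.\<close>
  define R where "R i = z $ i * (w \<bullet> B i) - w $ i * (w \<bullet> U i) + z $ i * (z \<bullet> U i) - w $ i * (z \<bullet> B i)" for i
  have ut: "w \<bullet> ut = (\<Sum>i\<in>UNIV. \<nu> * (w \<bullet> UU i) + b $ i * (w \<bullet> B i) - u $ i * (w \<bullet> U i) - w $ i * G $ i)"
    if "ut + (\<Sum>i\<in>UNIV. u $ i *\<^sub>R U i) + G
      = \<nu> *\<^sub>R (\<Sum>i\<in>UNIV. UU i) + (\<Sum>i\<in>UNIV. b $ i *\<^sub>R B i)"
    for ut u b G :: "real ^ 'n" and U B UU :: "'n \<Rightarrow> real ^ 'n"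
  proof -
    have "ut = \<nu> *\<^sub>R (\<Sum>i\<in>UNIV. UU i) + (\<Sum>i\<in>UNIV. b $ i *\<^sub>R B i) - (\<Sum>i\<in>UNIV. u $ i *\<^sub>R U i) - G"
      by (simp flip: that)
    then show ?thesis
      by (simp add: inner_simps inner_sum_right sum.distrib sum_subtractf sum_distrib_left inner_vec_def[of w G])
  qed
  have bt: "z \<bullet> bt = (\<Sum>i\<in>UNIV. \<eta> * (z \<bullet> BB i) + b $ i * (z \<bullet> U i) - u $ i * (z \<bullet> B i))"
    if "bt + (\<Sum>i\<in>UNIV. u $ i *\<^sub>R B i)
      = (\<Sum>i\<in>UNIV. b $ i *\<^sub>R U i) + \<eta> *\<^sub>R (\<Sum>i\<in>UNIV. BB i)"
    for bt u b :: "real ^ 'n" and U B BB :: "'n \<Rightarrow> real ^ 'n"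
  proof -
    have "bt = (\<Sum>i\<in>UNIV. b $ i *\<^sub>R U i) + \<eta> *\<^sub>R (\<Sum>i\<in>UNIV. BB i) - (\<Sum>i\<in>UNIV. u $ i *\<^sub>R B i)"
      by (simp flip: that)
    then show ?thesis
      by (simp add: inner_simps inner_sum_right sum.distrib sum_subtractf sum_distrib_left)
  qed
  have "w \<bullet> (ut' - ut) + z \<bullet> (bt' - bt)
      = (\<Sum>i\<in>UNIV. F i - \<nu> * (W i \<bullet> W i) - \<eta> * (Z i \<bullet> Z i) + R i
           + (U' i $ i * e + (U' i $ i - U i $ i) * \<pi> - B' i $ i * (w \<bullet> z)))"
    unfolding inner_diff_right ut[OF u] ut[OF u'] bt[OF b] bt[OF b']
    unfolding sum_subtractf[symmetric] sum.distrib[symmetric]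
  proof (rule sum.cong[OF refl])
    fix i
    have *: "u' = u + w" "b' = b + z" "U' i = U i + W i" "B' i = B i + Z i"
      by (simp_all add: w_def z_def W_def Z_def)
    show "\<nu> * (w \<bullet> UU' i) + b' $ i * (w \<bullet> B' i) - u' $ i * (w \<bullet> U' i) - w $ i * G' $ i -
         (\<nu> * (w \<bullet> UU i) + b $ i * (w \<bullet> B i) - u $ i * (w \<bullet> U i) - w $ i * G $ i) +
         (\<eta> * (z \<bullet> BB' i) + b' $ i * (z \<bullet> U' i) - u' $ i * (z \<bullet> B' i) -
          (\<eta> * (z \<bullet> BB i) + b $ i * (z \<bullet> U i) - u $ i * (z \<bullet> B i)))
       = F i - \<nu> * (W i \<bullet> W i) - \<eta> * (Z i \<bullet> Z i) + R i
           + (U' i $ i * e + (U' i $ i - U i $ i) * \<pi> - B' i $ i * (w \<bullet> z))"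
      unfolding F_def energy_flux_deriv_def R_def e_def W_def[symmetric] Z_def[symmetric] *
      by (simp add: inner_simps inner_commute[of "W i" z] field_simps)
  qed
  \<comment> \<open>Summed over \<open>i\<close>, the last bracket consists of multiples of the
    divergences of \<open>u'\<close>, \<open>u' - u\<close> and \<open>b'\<close>, all of which
    vanish.\<close>
  also have "\<dots> = (\<Sum>i\<in>UNIV. F i - \<nu> * (W i \<bullet> W i) - \<eta> * (Z i \<bullet> Z i) + R i)"
  proof -
    have "(\<Sum>i\<in>UNIV. U' i $ i * e + (U' i $ i - U i $ i) * \<pi> - B' i $ i * (w \<bullet> z)) = 0"
      using div by (simp add: sum.distrib sum_subtractf flip: sum_distrib_right)
    then show ?thesis by (simp only: sum.distrib add_0_right)
  qed
  also have "\<dots> \<le> (\<Sum>i\<in>UNIV. F i + 8 * K * e)"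
  proof (rule sum_mono)
    fix i
    define r where "r = sqrt (w \<bullet> w + z \<bullet> z)"
    have r: "norm w \<le> r" "norm z \<le> r" "r\<^sup>2 = 2 * e"
      by (auto simp: r_def norm_eq_sqrt_inner e_def)
    \<comment> \<open>Four terms of size at most \<open>K * r\<^sup>2\<close>, where
      \<open>r\<^sup>2 = 2 * e\<close>, account for the constant 8.\<close>
    have "R i \<le> 4 * (K * r\<^sup>2)"
      using stretching_term_le[OF K(2) r(1) r(2), of i i] stretching_term_le[OF K(1) r(1) r(1), of i i]
        stretching_term_le[OF K(1) r(2) r(2), of i i] stretching_term_le[OF K(2) r(2) r(1), of i i]
      unfolding R_def by linarith
    moreover have "0 \<le> \<nu> * (W i \<bullet> W i)" "0 \<le> \<eta> * (Z i \<bullet> Z i)"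
      using \<nu> \<eta> by auto
    ultimately show "F i - \<nu> * (W i \<bullet> W i) - \<eta> * (Z i \<bullet> Z i) + R i \<le> F i + 8 * K * e"
      unfolding r(3) by linarith
  qed
  also have "\<dots> = (\<Sum>i\<in>UNIV. F i) + real CARD('n) * (8 * K) * e"
    by (simp add: sum.distrib)
  finally show ?thesis unfolding F_def e_def .
qed

text \<open>The function \<open>exp (- C * t) * E t\<close> has nonpositive derivative and starts at
  0; the mean value theorem then bounds its value at \<open>\<tau>\<close> by 0.\<close>

lemma gronwall_zero:
  fixes E :: "real \<Rightarrow> real"
  assumes der: "\<And>t. t \<in> {0..\<tau>} \<Longrightarrow> (E has_real_derivative E' t) (at t within {0..\<tau>})"
    and le: "\<And>t. t \<in> {0..\<tau>} \<Longrightarrow> E' t \<le> C * E t"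
    and E: "E 0 = 0" "0 \<le> E \<tau>" and \<tau>: "0 \<le> \<tau>"
  shows "E \<tau> = 0"
proof -
  define g where "g t = exp (- C * t) * E t" for t
  have g: "(g has_real_derivative exp (- C * t) * (E' t - C * E t)) (at t within {0..\<tau>})"
    if "t \<in> {0..\<tau>}" for t
    unfolding g_def by (rule derivative_eq_intros der that refl)+ (simp add: algebra_simps)
  have "\<exists>t\<in>{0..\<tau>}. g \<tau> - g 0 = (exp (- C * t) * (E' t - C * E t)) * (\<tau> - 0)"
    using g by (intro mvt_very_simple \<tau>) (auto simp: has_field_derivative_def)
  then obtain t where t: "t \<in> {0..\<tau>}" "g \<tau> - g 0 = (exp (- C * t) * (E' t - C * E t)) * \<tau>"
    by auto
  have "(exp (- C * t) * (E' t - C * E t)) * \<tau> \<le> 0"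
    using le[OF t(1)] \<tau> by (intro mult_nonpos_nonneg mult_nonneg_nonpos) auto
  then have "exp (- C * \<tau>) * E \<tau> \<le> 0"
    using t(2) E(1) by (simp add: g_def)
  then show ?thesis
    using E(2) by (simp add: mult_le_0_iff)
qed

lemma continuous_eq_0_of_integral_cube:
  fixes f :: "real ^ 'n::finite \<Rightarrow> real"
  assumes "continuous_on torus_cube f" "\<And>x. 0 \<le> f x" "integral torus_cube f = 0" "x \<in> torus_cube"
  shows "f x = 0"
proof (rule has_integral_0_cbox_imp_0[OF assms(1)])
  show "(f has_integral 0) torus_cube"
    using integrable_integral[OF integrable_continuous[OF assms(1)]] assms(3) by simp
  have "(\<chi> i. pi) \<in> box (0 :: real ^ 'n) (\<chi> i. 2 * pi)"
    by (simp add: mem_box_cart)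
  then show "box (0 :: real ^ 'n) (\<chi> i. 2 * pi) \<noteq> {}" by blast
qed (use assms in auto)

lemma global_smooth_bounded_on_cube:
  assumes f: "global_smooth f"
  obtains K where "\<And>t x. t \<in> {0..\<tau>} \<Longrightarrow> x \<in> torus_cube \<Longrightarrow> norm (f t (to_torus x)) \<le> K"
proof -
  have "compact ((\<lambda>(t, x). f t (to_torus x)) ` ({0..\<tau>} \<times> torus_cube))"
    by (intro compact_continuous_image continuous_on_subset[OF global_smooth_continuous_on[OF f]]
        compact_Times) auto
  from compact_imp_bounded[OF this] that show ?thesis
    unfolding bounded_iff by fastforce
qed

text \<open>The energy of the difference satisfies a linear differential inequality on
  \<open>{0..\<tau>}\<close> with zero initial value. Its constant involves only derivatives of the
  first solution, which are bounded on the compact set \<open>{0..\<tau>}\<close> times the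
  cube.\<close>

lemma MHD_unique:
  fixes u b u' b' :: "real \<Rightarrow> 'n::finite torus \<Rightarrow> real ^ 'n"
  assumes sol: "MHD_global_smooth_solution \<nu> \<eta> u0 b0 u b"
    and sol': "MHD_global_smooth_solution \<nu> \<eta> u0 b0 u' b'"
    and \<nu>: "\<nu> \<ge> 0" and \<eta>: "\<eta> \<ge> 0" and \<tau>: "\<tau> \<ge> 0"
  shows "u' \<tau> = u \<tau> \<and> b' \<tau> = b \<tau>"
proof -
  obtain P where P: "global_smooth P"
      "\<And>t p. t \<ge> 0 \<Longrightarrow> time_deriv u t p + advect (u t) (u t) p + gradient (P t) p
                    = \<nu> *\<^sub>R laplacian (u t) p + advect (b t) (b t) p"
    and smooth: "global_smooth u" "global_smooth b"
    and b_eq: "\<And>t p. t \<ge> 0 \<Longrightarrow> time_deriv b t p + advect (u t) (b t) p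
                    = advect (b t) (u t) p + \<eta> *\<^sub>R laplacian (b t) p"
    and div: "\<And>t p. t \<ge> 0 \<Longrightarrow> divergence (u t) p = 0"
    and init: "u 0 = u0" "b 0 = b0"
    using sol unfolding MHD_global_smooth_solution_def divergence_free_def by blast
  obtain P' where P': "global_smooth P'"
      "\<And>t p. t \<ge> 0 \<Longrightarrow> time_deriv u' t p + advect (u' t) (u' t) p + gradient (P' t) p
                    = \<nu> *\<^sub>R laplacian (u' t) p + advect (b' t) (b' t) p"
    and smooth': "global_smooth u'" "global_smooth b'"
    and b_eq': "\<And>t p. t \<ge> 0 \<Longrightarrow> time_deriv b' t p + advect (u' t) (b' t) p
                    = advect (b' t) (u' t) p + \<eta> *\<^sub>R laplacian (b' t) p"
    and div': "\<And>t p. t \<ge> 0 \<Longrightarrow> divergence (u' t) p = 0" "\<And>t p. t \<ge> 0 \<Longrightarrow> divergence (b' t) p = 0"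
    and init': "u' 0 = u0" "b' 0 = b0"
    using sol' unfolding MHD_global_smooth_solution_def divergence_free_def by blast
  note smooths = smooth smooth' P(1) P'(1)
  note partials = smooths[THEN global_smooth_has_partial]
    smooth[THEN global_smooth_partial, THEN global_smooth_has_partial]
    smooth'[THEN global_smooth_partial, THEN global_smooth_has_partial]
  note conts = smooths[THEN global_smooth_continuous_slice]
    smooths[THEN global_smooth_partial, THEN global_smooth_continuous_slice]
    smooth[THEN global_smooth_partial, THEN global_smooth_partial, THEN global_smooth_continuous_slice]
    smooth'[THEN global_smooth_partial, THEN global_smooth_partial, THEN global_smooth_continuous_slice]

  \<comment> \<open>Moves the component outside the derivative, the form in which
    \<open>energy_pointwise_le\<close> expects the divergence.\<close>
  have div_eq: "divergence v p = (\<Sum>i\<in>UNIV. partial i v p $ i)"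
    if "\<And>i. has_partial i v (partial i v p) p" for v :: "'n torus \<Rightarrow> real ^ 'n" and p
    unfolding divergence_def using partial_eqI[OF has_partial_nth[OF that]] by simp

  \<comment> \<open>Energy and flux of the difference of two solutions\<close>
  define w where "w t p = u' t p - u t p" for t p
  define z where "z t p = b' t p - b t p" for t p
  define e where "e t p = (w t p \<bullet> w t p + z t p \<bullet> z t p) / 2" for t p
  define et where "et t p = w t p \<bullet> (time_deriv u' t p - time_deriv u t p)
     + z t p \<bullet> (time_deriv b' t p - time_deriv b t p)" for t p
  define F where "F t i p = energy_flux_deriv \<nu> \<eta> (u' t p) (b' t p) (w t p) (z t p)
      (partial i (u' t) p - partial i (u t) p) (partial i (b' t) p - partial i (b t) p)
      (partial i (partial i (u' t)) p - partial i (partial i (u t)) p)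
      (partial i (partial i (b' t)) p - partial i (partial i (b t)) p)
      (partial i (u' t) p $ i) (partial i (b' t) p $ i) (P' t p - P t p)
      (gradient (P' t) p $ i - gradient (P t) p $ i) i" for t i p
  define flux where "flux t i p =
      \<nu> * (w t p \<bullet> (partial i (u' t) p - partial i (u t) p))
      + \<eta> * (z t p \<bullet> (partial i (b' t) p - partial i (b t) p))
      - u' t p $ i * e t p - w t p $ i * (P' t p - P t p) + b' t p $ i * (w t p \<bullet> z t p)" for t i p

  have flux: "has_partial i (flux t i) (F t i p) p" if t: "t \<ge> 0" for t i p
  proof -
    have half: "has_partial i (\<lambda>q. f q / 2) (D / 2) p" if "has_partial i f D p" for f and D :: real
      using has_partial_bounded_linear[OF bounded_linear_divide that] .
    have scale: "has_partial i (\<lambda>q. c * f q) (c * D) p" if "has_partial i f D p" for f and c D :: real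
      using has_partial_bounded_linear[OF bounded_linear_mult_right that] .
    have eq: "has_partial i f D' p" if "has_partial i f D p" "D = D'" for f and D D' :: real
      using that by simp
    show ?thesis
      unfolding flux_def e_def w_def z_def
      by (rule eq, (rule scale half has_partial_add has_partial_diff has_partial_mult has_partial_inner
          has_partial_nth partials[OF t] | assumption)+)
         (simp add: F_def energy_flux_deriv_def w_def z_def e_def gradient_def inner_commute
          field_simps inner_simps)
  qed
  have flux_cont: "continuous_on UNIV (\<lambda>x. flux t i (to_torus x))"
    "continuous_on UNIV (\<lambda>x. F t i (to_torus x))" if "t \<ge> 0" for t i
    unfolding flux_def F_def energy_flux_deriv_def w_def z_def e_def gradient_def vec_lambda_beta
    by (intro continuous_intros conts[OF that]; simp)+
  have e_cont: "continuous_on S (\<lambda>x. e t (to_torus x))" if "t \<ge> 0" for t S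
    unfolding e_def w_def z_def by (intro continuous_intros conts[OF that]; simp)

  \<comment> \<open>Time derivative of the total energy\<close>
  define E where "E t = integral torus_cube (\<lambda>x. e t (to_torus x))" for t
  define E' where "E' t = integral torus_cube (\<lambda>x. et t (to_torus x))" for t
  note joint = smooth[THEN global_smooth_continuous_on] smooth'[THEN global_smooth_continuous_on]
    smooth[THEN global_smooth_time_deriv, THEN global_smooth_continuous_on]
    smooth'[THEN global_smooth_time_deriv, THEN global_smooth_continuous_on]
  have et_joint: "continuous_on ({0..} \<times> torus_cube) (\<lambda>(t, x). et t (to_torus x))"
    unfolding et_def w_def z_def case_prod_unfold
    by (intro continuous_intros joint[unfolded case_prod_unfold, THEN continuous_on_subset]) auto
  have et_cont: "continuous_on torus_cube (\<lambda>x. et t (to_torus x))" if "t \<ge> 0" for t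
  proof -
    have "continuous_on torus_cube (\<lambda>x. (t, x))"
      by (intro continuous_intros)
    from continuous_on_compose2[OF et_joint this] that show ?thesis
      by (simp add: image_subset_iff)
  qed
  have E_deriv: "(E has_vector_derivative E' t) (at t within {0..})" if "t \<ge> 0" for t
    unfolding E_def E'_def
  proof (rule leibniz_rule_vector_derivative)
    show "((\<lambda>t. e t (to_torus x)) has_vector_derivative et t (to_torus x)) (at t within {0..})"
      if "t \<in> {0..}" for t x
    proof -
      have t: "t \<ge> 0" using that by simp
      note d = smooth[THEN global_smooth_has_time_deriv, OF t, of "to_torus x"]
        smooth'[THEN global_smooth_has_time_deriv, OF t, of "to_torus x"]
      have "((\<lambda>s. (w s (to_torus x) \<bullet> w s (to_torus x) + z s (to_torus x) \<bullet> z s (to_torus x)) / 2)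
          has_vector_derivative (2 * et t (to_torus x)) / 2) (at t within {0..})"
        unfolding et_def w_def z_def
        by (rule bounded_linear.has_vector_derivative[OF bounded_linear_divide])
           (auto intro!: derivative_eq_intros d
              bounded_bilinear.has_vector_derivative[OF bounded_bilinear_inner, THEN has_vector_derivative_eq_rhs]
              simp: inner_simps inner_commute algebra_simps)
      then show ?thesis unfolding e_def by simp
    qed
  qed (use that et_joint e_cont in \<open>auto intro: integrable_continuous\<close>)

  \<comment> \<open>Uniform bounds on the derivatives of the first solution\<close>
  have "\<exists>K. \<forall>i. \<forall>t\<in>{0..\<tau>}. \<forall>x\<in>torus_cube. norm (partial i (f t) (to_torus x)) \<le> K"
    if "global_smooth f" for f :: "real \<Rightarrow> 'n torus \<Rightarrow> real ^ 'n"
  proof -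
    have "\<exists>K. \<forall>t\<in>{0..\<tau>}. \<forall>x\<in>torus_cube. norm (partial i (f t) (to_torus x)) \<le> K" for i
      using global_smooth_bounded_on_cube[OF global_smooth_partial[OF that], of \<tau> i] by metis
    then obtain K where "\<forall>i. \<forall>t\<in>{0..\<tau>}. \<forall>x\<in>torus_cube. norm (partial i (f t) (to_torus x)) \<le> K i"
      by metis
    moreover have "K i \<le> Max (range K)" for i
      by simp
    ultimately show ?thesis
      by (meson order_trans)
  qed
  from this[OF smooth(1)] this[OF smooth(2)] obtain K1 K2
    where K1: "\<And>i t x. t \<in> {0..\<tau>} \<Longrightarrow> x \<in> torus_cube \<Longrightarrow> norm (partial i (u t) (to_torus x)) \<le> K1"
    and K2: "\<And>i t x. t \<in> {0..\<tau>} \<Longrightarrow> x \<in> torus_cube \<Longrightarrow> norm (partial i (b t) (to_torus x)) \<le> K2"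
    by blast
  \<comment> \<open>The constant of \<open>energy_pointwise_le\<close>, with a common bound for the
    derivatives of \<open>u\<close> and \<open>b\<close>.\<close>
  define C where "C = real CARD('n) * (8 * max K1 K2)"

  \<comment> \<open>Energy inequality and conclusion\<close>
  have E_le: "E' t \<le> C * E t" if t: "t \<in> {0..\<tau>}" for t
  proof -
    have t0: "t \<ge> 0" using t by simp
    have "et t (to_torus x) \<le> (\<Sum>i\<in>UNIV. F t i (to_torus x)) + C * e t (to_torus x)"
      if x: "x \<in> torus_cube" for x
    proof -
      let ?p = "to_torus x"
      show ?thesis
        unfolding et_def F_def C_def e_def w_def z_def
        using P(2)[OF t0, of ?p] P'(2)[OF t0, of ?p] b_eq[OF t0, of ?p] b_eq'[OF t0, of ?p]
          div[OF t0, of ?p] div'(1)[OF t0, of ?p] div'(2)[OF t0, of ?p] \<nu> \<eta>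
        by (intro energy_pointwise_le)
           (auto simp: advect_def laplacian_def div_eq[OF partials(1)[OF t0]]
            div_eq[OF partials(3)[OF t0]] div_eq[OF partials(4)[OF t0]] le_max_iff_disj K1[OF t x] K2[OF t x])
    qed
    moreover have "(\<lambda>x. et t (to_torus x)) integrable_on torus_cube"
      by (intro integrable_continuous et_cont t0)
    moreover have "(\<lambda>x. (\<Sum>i\<in>UNIV. F t i (to_torus x)) + C * e t (to_torus x)) integrable_on torus_cube"
      by (intro integrable_continuous continuous_intros e_cont[OF t0] continuous_on_subset[OF flux_cont(2)[OF t0]]) auto
    ultimately have "E' t \<le> integral torus_cube (\<lambda>x. (\<Sum>i\<in>UNIV. F t i (to_torus x)) + C * e t (to_torus x))"
      unfolding E'_def by (intro integral_le) auto
    also have "\<dots> = (\<Sum>i\<in>UNIV. integral torus_cube (\<lambda>x. F t i (to_torus x))) + C * E t"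
    proof -
      have "(\<lambda>x. F t i (to_torus x)) integrable_on torus_cube" for i
        by (intro integrable_continuous continuous_on_subset[OF flux_cont(2)[OF t0]]) auto
      moreover have "(\<lambda>x. e t (to_torus x)) integrable_on torus_cube"
        by (intro integrable_continuous e_cont t0)
      ultimately show ?thesis
        unfolding E_def
        by (subst Henstock_Kurzweil_Integration.integral_add)
           (auto simp: Henstock_Kurzweil_Integration.integral_sum intro!: integrable_sum integrable_on_mult_right)
    qed
    \<comment> \<open>Each \<open>F t i\<close> is the \<open>i\<close>-th partial derivative of a
      continuous periodic flux, so its integral vanishes.\<close>
    also have "\<dots> = C * E t"
      using integral_partial_eq_0[OF flux[OF t0] flux_cont[OF t0]] by simp
    finally show ?thesis .
  qed
  have "E \<tau> = 0"
  proof (rule gronwall_zero[where E = E and E' = E' and C = C and \<tau> = \<tau>])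
    show "(E has_real_derivative E' t) (at t within {0..\<tau>})" if "t \<in> {0..\<tau>}" for t
      using has_vector_derivative_within_subset[OF E_deriv, of t "{0..\<tau>}"] that
      by (auto simp: has_real_derivative_iff_has_vector_derivative)
    show "E 0 = 0"
      by (simp add: E_def e_def w_def z_def init init')
    show "0 \<le> E \<tau>"
      unfolding E_def by (intro integral_nonneg integrable_continuous e_cont \<tau>) (simp add: e_def)
  qed (use E_le \<tau> in auto)
  then have "e \<tau> (to_torus x) = 0" if "x \<in> torus_cube" for x
    unfolding E_def by (intro continuous_eq_0_of_integral_cube[of "\<lambda>x. e \<tau> (to_torus x)"] e_cont \<tau> that)
      (simp_all add: e_def)
  then have "e \<tau> p = 0" for p
    by (metis to_torus_cube)
  then have "w \<tau> p = 0 \<and> z \<tau> p = 0" for p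
    by (simp add: e_def add_nonneg_eq_0_iff)
  then show ?thesis
    by (auto simp: w_def z_def fun_eq_iff)
qed

section \<open>Shear fields\<close>

text \<open>Periodicity is stated for all integer multiples of the period so that it matches the
  shifts in \<open>torus_rel\<close>.\<close>

definition circle_fun :: "(real \<Rightarrow> real) \<Rightarrow> bool" where
  "circle_fun \<phi> \<longleftrightarrow> (\<forall>y (k::int). \<phi> (y + 2 * pi * of_int k) = \<phi> y)"

text \<open>The profile is evaluated at a chosen representative; for a periodic profile the value
  does not depend on that choice.\<close>

definition shear :: "'n::finite \<Rightarrow> 'n \<Rightarrow> (real \<Rightarrow> real) \<Rightarrow> 'n torus \<Rightarrow> real ^ 'n" where
  "shear i j \<phi> p = \<phi> (rep_torus p $ j) *\<^sub>R axis i 1"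

lemma rep_to_torus_nth: "\<exists>k::int. rep_torus (to_torus x) $ j = x $ j + 2 * pi * of_int k"
proof -
  have "torus_rel (rep_torus (to_torus x)) x"
    by (simp flip: to_torus_eq_iff)
  then show ?thesis by (simp add: torus_rel_def)
qed

lemma circle_fun_rep_to_torus: "circle_fun \<phi> \<Longrightarrow> \<phi> (rep_torus (to_torus x) $ j) = \<phi> (x $ j)"
  using rep_to_torus_nth[of x j] by (auto simp: circle_fun_def)

lemma shear_to_torus: "circle_fun \<phi> \<Longrightarrow> shear i j \<phi> (to_torus x) = \<phi> (x $ j) *\<^sub>R axis i 1"
  by (simp add: shear_def circle_fun_rep_to_torus)

lemma circle_fun_sin: "circle_fun (\<lambda>y. sin (of_int m * y))"
  and circle_fun_cos: "circle_fun (\<lambda>y. cos (of_int m * y))"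
proof -
  have *: "of_int m * (y + 2 * pi * of_int k) = of_int m * y + 2 * pi * of_int (m * k)" for y k
    by (simp add: algebra_simps)
  show "circle_fun (\<lambda>y. sin (of_int m * y))" "circle_fun (\<lambda>y. cos (of_int m * y))"
    unfolding circle_fun_def * sin_add cos_add
    by (simp_all add: sin_int_2pin cos_int_2pin del: of_int_mult)
qed

lemma has_partial_shear:
  fixes i j k :: "'n::finite"
  assumes "\<And>y. (\<phi> has_real_derivative \<phi>' y) (at y)" "circle_fun \<phi>" "circle_fun \<phi>'"
  shows "has_partial k (shear i j \<phi>) (if k = j then shear i j \<phi>' p else 0) p"
proof -
  obtain x where p: "p = to_torus x" by (rule torus_cases)
  have "((\<lambda>s. \<phi> (x $ j + s)) has_real_derivative \<phi>' (x $ j)) (at 0)"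
    using DERIV_shift[of \<phi> "\<phi>' (x $ j)" 0 "x $ j"] assms(1) by (simp add: add.commute)
  then have "((\<lambda>s. \<phi> (x $ j + s) *\<^sub>R (axis i 1 :: real ^ 'n)) has_vector_derivative
      \<phi>' (x $ j) *\<^sub>R axis i 1) (at 0)"
    by (auto intro!: derivative_eq_intros)
  then show ?thesis
    by (auto simp: has_partial_def p shear_to_torus assms(2,3) axis_def)
qed

lemma continuous_on_shear:
  assumes "circle_fun \<phi>" "continuous_on UNIV \<phi>"
  shows "continuous_on S (\<lambda>x. shear i j \<phi> (to_torus x))"
  unfolding shear_to_torus[OF assms(1)]
  by (intro continuous_intros continuous_on_compose2[OF assms(2)]) auto

context
  fixes i j :: "'n::finite" and \<phi> \<phi>' :: "real \<Rightarrow> real"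
  assumes ij: "i \<noteq> j"
    and \<phi>: "\<And>y. (\<phi> has_real_derivative \<phi>' y) (at y)" "circle_fun \<phi>" "circle_fun \<phi>'"
begin

lemma partial_shear: "partial k (shear i j \<phi>) = (if k = j then shear i j \<phi>' else (\<lambda>_. 0))"
  using partial_eqI[OF has_partial_shear[OF \<phi>, of k i j]] by auto

text \<open>Only the component \<open>i\<close> is nonzero, and it varies only in the direction
  \<open>j\<close>.\<close>

lemma divergence_free_shear: "divergence_free (shear i j \<phi>)"
proof -
  have "\<phi> differentiable (at y)" for y
    using \<phi>(1) by (auto simp: real_differentiable_def)
  then have "(\<lambda>x. \<phi> (x $ j)) differentiable (at x)" for x :: "real ^ 'n"
    using differentiable_compose[of \<phi> "\<lambda>x. x $ j" x UNIV]
      bounded_linear_imp_differentiable[OF bounded_linear_vec_nth[of j], of "at x"] by blast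
  then have "(\<lambda>x. \<phi> (x $ j) *\<^sub>R (axis i 1 :: real ^ 'n)) differentiable_on UNIV"
    unfolding differentiable_on_def by (intro ballI differentiable_scaleR) auto
  moreover have "partial k (\<lambda>q. shear i j \<phi> q $ k) p = 0" for k p
    using partial_eqI[OF has_partial_nth[OF has_partial_shear[OF \<phi>, of k i j p], of k]] ij
    by (auto simp: shear_def axis_def split: if_splits)
  ultimately show ?thesis
    by (simp add: divergence_free_def divergence_def shear_to_torus \<phi>(2))
qed

text \<open>The only nonzero partial derivative is the \<open>j\<close>-th, and its coefficient is
  the vanishing \<open>j\<close>-th component of the field.\<close>

lemma advect_shear: "advect (shear i j \<phi>) (shear i j \<phi>) p = 0"
  unfolding advect_def partial_shear using ij
  by (intro sum.neutral) (auto simp: shear_def axis_def)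

text \<open>A profile with a periodic primitive gives a field that is itself a \<open>j\<close>-th
  partial derivative; this yields the zero average.\<close>

lemma integral_shear_deriv:
  assumes "continuous_on UNIV \<phi>'"
  shows "(\<integral>p. shear i j \<phi>' p \<partial>torus_measure) = 0"
proof -
  have "continuous_on UNIV \<phi>"
    using \<phi>(1) by (intro DERIV_continuous_on) (auto intro: has_field_derivative_at_within)
  then show ?thesis
    using integral_partial_eq_0[of j "shear i j \<phi>" "shear i j \<phi>'"] has_partial_shear[OF \<phi>, of j i j]
    by (simp add: integral_torus continuous_on_shear \<phi> assms)
qed

lemma laplacian_shear:
  assumes "\<And>y. (\<phi>' has_real_derivative \<phi>'' y) (at y)" "circle_fun \<phi>''"
  shows "laplacian (shear i j \<phi>) p = shear i j \<phi>'' p"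
proof -
  have "partial k (partial k (shear i j \<phi>)) p = (if k = j then shear i j \<phi>'' p else 0)" for k
    using partial_eqI[OF has_partial_shear[OF assms(1) \<phi>(3) assms(2), of j i j]]
      partial_eqI[OF has_partial_const[of k "0::real^'n"]]
    by (simp add: partial_shear)
  then show ?thesis by (simp add: laplacian_def)
qed

end

text \<open>The phase \<open>c\<close> closes the family under differentiation: the cosine is the
  sine with phase advanced by \<open>pi / 2\<close>, so a directional derivative combines two
  members and the induction runs with \<open>c\<close> arbitrary.\<close>

lemma Ck_on_decaying_mode:
  "Ck_on k (\<lambda>z :: real \<times> (real ^ 'n::finite). (exp (- \<alpha> * fst z) * sin (m * snd z $ j + c)) *\<^sub>R v) S"
proof (induction k arbitrary: c)
  case 0
  show ?case by (auto intro!: continuous_intros)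
next
  case (Suc k)
  let ?h = "\<lambda>c (z :: real \<times> (real ^ 'n)). (exp (- \<alpha> * fst z) * sin (m * snd z $ j + c)) *\<^sub>R v"
  let ?D = "\<lambda>z d. (- \<alpha> * fst d) *\<^sub>R ?h c z + (m * snd d $ j) *\<^sub>R ?h (c + pi / 2) z"
  have "(?h c has_derivative ?D z) (at z within S)" for z
  proof -
    have nth: "((\<lambda>z. snd z $ j) has_derivative (\<lambda>d. snd d $ j)) (at z within S)"
      by (rule bounded_linear.has_derivative[OF bounded_linear_vec_nth]) (auto intro: derivative_intros)
    have "sin (m * snd z $ j + (c + pi / 2)) = cos (m * snd z $ j + c)"
      by (simp add: sin_add cos_add)
    then show ?thesis
      by (auto intro!: derivative_eq_intros nth simp: fun_eq_iff algebra_simps)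
  qed
  moreover have "Ck_on k (\<lambda>z. ?D z d) S" for d
    by (intro Ck_on_add Ck_on_bounded_linear[OF bounded_linear_scaleR_right] Suc.IH)
  ultimately show ?case
    unfolding Ck_on.simps by (intro exI[of _ ?D]) blast
qed

section \<open>Integral lines\<close>

lemma integral_lineE:
  assumes "L \<in> integral_lines v"
  obtains \<gamma> I g where "L = \<gamma> ` I" "open I" "is_interval I" "I \<noteq> {}"
    "\<And>s. s \<in> I \<Longrightarrow> \<gamma> s = to_torus (g s)"
    "\<And>s. s \<in> I \<Longrightarrow> (g has_vector_derivative v (\<gamma> s)) (at s)"
proof -
  obtain \<gamma> I where L: "L = \<gamma> ` I" and "integral_curve v I \<gamma>"
    using assms unfolding integral_lines_def maximal_integral_curve_def by blast
  then show ?thesis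
    unfolding integral_curve_def using that[OF L] by metis
qed

text \<open>The constant curve is defined on the whole real line and hence cannot be
  extended.\<close>

lemma stationary_integral_line:
  assumes "v p = 0"
  shows "{p} \<in> integral_lines v"
proof -
  have "maximal_integral_curve v UNIV (\<lambda>_. p)"
    unfolding maximal_integral_curve_def integral_curve_def
    by (auto simp: assms intro!: exI[of _ "\<lambda>_. rep_torus p"])
  then show ?thesis
    unfolding integral_lines_def by force
qed

lemma constant_on_interval:
  fixes g :: "real \<Rightarrow> 'a::real_normed_vector"
  assumes "is_interval I" "\<And>s. s \<in> I \<Longrightarrow> (g has_vector_derivative 0) (at s)" "s \<in> I" "t \<in> I"
  shows "g s = g t"
proof -
  have "convex I" using assms(1) by (simp add: is_interval_convex)
  then obtain c where "\<And>x. x \<in> I \<Longrightarrow> g x = c"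
    by (rule has_vector_derivative_zero_constant[of I g]) (use assms(2) in \<open>auto intro: has_vector_derivative_at_within\<close>)
  then show ?thesis using assms by simp
qed

text \<open>A curve that rests at \<open>p\<close> has a lift moving with constant velocity
  \<open>v p\<close>. Were that nonzero, a short time would displace the lift by a nonzero amount
  less than a period, hence move the point on the torus.\<close>

lemma stationary_of_singleton_integral_line:
  assumes "{p} \<in> integral_lines v"
  shows "v p = 0"
proof (rule ccontr)
  assume "v p \<noteq> 0"
  then obtain i where i: "v p $ i \<noteq> 0" by (auto simp: vec_eq_iff)
  obtain \<gamma> I g where img: "{p} = \<gamma> ` I" and I: "open I" "is_interval I" "I \<noteq> {}"
    and g: "\<And>s. s \<in> I \<Longrightarrow> \<gamma> s = to_torus (g s)"
      "\<And>s. s \<in> I \<Longrightarrow> (g has_vector_derivative v (\<gamma> s)) (at s)"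
    using integral_lineE[OF assms] by metis
  obtain s where s: "s \<in> I" using I by auto
  obtain \<epsilon> where \<epsilon>: "\<epsilon> > 0" "ball s \<epsilon> \<subseteq> I" using I(1) s openE by blast
  \<comment> \<open>Short enough to stay in the interval and to move the coordinate \<open>i\<close>
    by at most \<open>pi\<close>, below the period.\<close>
  define d where "d = min (\<epsilon> / 2) (pi / \<bar>v p $ i\<bar>)"
  have d: "0 < d" "d * \<bar>v p $ i\<bar> \<le> pi" "d \<le> \<epsilon> / 2"
    using \<epsilon> i by (auto simp: d_def min_def field_simps)
  have sd: "s + d \<in> I" using \<epsilon> d by (auto simp: dist_norm subset_iff)
  have \<gamma>: "\<gamma> r = p" if "r \<in> I" for r using img that by auto
  have "((\<lambda>r. g r - r *\<^sub>R v p) has_vector_derivative 0) (at r)" if "r \<in> I" for r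
    using g(2)[OF that] \<gamma>[OF that] by (auto intro!: derivative_eq_intros)
  from constant_on_interval[OF I(2) this sd s]
  have "g (s + d) = g s + d *\<^sub>R v p" by (simp add: algebra_simps)
  moreover have "torus_rel (g (s + d)) (g s)"
    using g(1)[OF s] g(1)[OF sd] \<gamma>[OF s] \<gamma>[OF sd] by (simp flip: to_torus_eq_iff)
  ultimately obtain k :: int where k: "d * v p $ i = 2 * pi * of_int k"
    by (auto simp: torus_rel_def)
  then have "d * \<bar>v p $ i\<bar> = 2 * pi * \<bar>of_int k\<bar>"
    using d(1) by (metis abs_mult abs_of_pos pi_gt_zero zero_less_numeral abs_numeral)
  moreover have "k \<noteq> 0" using k d i by auto
  then have "1 \<le> \<bar>of_int k :: real\<bar>" by linarith
  then have "2 * pi * 1 \<le> 2 * pi * \<bar>of_int k\<bar>" by (intro mult_left_mono) auto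
  ultimately show False using d(2) pi_gt_zero by linarith
qed

text \<open>The coordinate \<open>j\<close> is constant along the flow, so the curve through
  \<open>p\<close> is a straight line run at constant speed for all times, and thus maximal.\<close>

lemma shear_integral_line:
  assumes "i \<noteq> j" "circle_fun \<phi>"
  obtains L where "L \<in> integral_lines (shear i j \<phi>)" "p \<in> L"
proof -
  define g where "g s = rep_torus p + (s * \<phi> (rep_torus p $ j)) *\<^sub>R axis i 1" for s
  have gj: "g s $ j = rep_torus p $ j" for s
    using assms(1) by (simp add: g_def axis_def)
  have "(g has_vector_derivative \<phi> (rep_torus p $ j) *\<^sub>R axis i 1) (at s)" for s
    unfolding g_def by (auto intro!: derivative_eq_intros)
  then have "maximal_integral_curve (shear i j \<phi>) UNIV (\<lambda>s. to_torus (g s))"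
    unfolding maximal_integral_curve_def integral_curve_def
    by (auto simp: shear_to_torus assms(2) gj intro!: exI[of _ g])
  moreover have "p = to_torus (g 0)" by (simp add: g_def)
  ultimately show ?thesis
    using that[of "range (\<lambda>s. to_torus (g s))"] unfolding integral_lines_def by blast
qed

text \<open>A shear is constant along its integral curves, so no curve runs into a zero.\<close>

lemma shear_integral_line_stationary:
  assumes ij: "i \<noteq> j" and \<phi>: "circle_fun \<phi>"
    and L: "L \<in> integral_lines (shear i j \<phi>)" "q \<in> L" "shear i j \<phi> q = 0"
  shows "L = {q}"
proof -
  obtain \<gamma> I g where img: "L = \<gamma> ` I" and I: "is_interval I"
    and g: "\<And>s. s \<in> I \<Longrightarrow> \<gamma> s = to_torus (g s)"
      "\<And>s. s \<in> I \<Longrightarrow> (g has_vector_derivative shear i j \<phi> (\<gamma> s)) (at s)"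
    using integral_lineE[OF L(1)] by metis
  obtain r where r: "r \<in> I" "q = \<gamma> r" using L(2) img by auto
  have g': "(g has_vector_derivative \<phi> (g s $ j) *\<^sub>R axis i 1) (at s)" if "s \<in> I" for s
    using g(1,2)[OF that] by (simp add: shear_to_torus \<phi>)
  have "((\<lambda>s. g s $ j) has_vector_derivative 0) (at s)" if "s \<in> I" for s
    using bounded_linear.has_vector_derivative[OF bounded_linear_vec_nth g'[OF that], of j] ij
    by (simp add: axis_def)
  then have gj: "g s $ j = g r $ j" if "s \<in> I" for s
    by (rule constant_on_interval[OF I _ that r(1), of "\<lambda>s. g s $ j"])
  have "\<phi> (g r $ j) = 0"
    using L(3) g(1)[OF r(1)] r(2) by (simp add: shear_to_torus \<phi> axis_eq_0_iff)
  then have "(g has_vector_derivative 0) (at s)" if "s \<in> I" for s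
    using g'[OF that] gj[OF that] by simp
  then have "g s = g r" if "s \<in> I" for s
    by (rule constant_on_interval[OF I _ that r(1)])
  then have "\<gamma> s = q" if "s \<in> I" for s
    using that g(1) r by metis
  then show ?thesis unfolding img using r(1) by blast
qed

text \<open>Zeros are the points whose magnetic line is a singleton. The homeomorphism is only
  assumed to send lines to lines, so for the converse a line through \<open>p\<close> is followed:
  its image is a line through the zero \<open>h p\<close>, hence a singleton, and injectivity of
  \<open>h\<close> finishes.\<close>

lemma topologically_equivalent_shear_zeros:
  assumes ij: "i \<noteq> j" and \<phi>: "circle_fun \<phi>" and \<psi>: "circle_fun \<psi>"
    and eq: "topologically_equivalent (shear i j \<phi>) (shear i j \<psi>)"
  obtains h k where "homeomorphism UNIV UNIV h k"
    "\<And>p. shear i j \<phi> p = 0 \<longleftrightarrow> shear i j \<psi> (h p) = 0"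
proof -
  obtain h k where hk: "homeomorphism UNIV UNIV h k"
    and lines: "\<And>L. L \<in> integral_lines (shear i j \<phi>) \<Longrightarrow> h ` L \<in> integral_lines (shear i j \<psi>)"
    using eq unfolding topologically_equivalent_def by blast
  have inj: "inj h"
    using hk by (metis homeomorphism_apply1 inj_on_def iso_tuple_UNIV_I)
  have "shear i j \<psi> (h p) = 0" if "shear i j \<phi> p = 0" for p
    using lines[OF stationary_integral_line[of "shear i j \<phi>", OF that]]
    by (intro stationary_of_singleton_integral_line) simp
  moreover have "shear i j \<phi> p = 0" if "shear i j \<psi> (h p) = 0" for p
  proof -
    obtain L where L: "L \<in> integral_lines (shear i j \<phi>)" "p \<in> L"
      using shear_integral_line[OF ij \<phi>] .
    have "h ` L = {h p}"
      using shear_integral_line_stationary[OF ij \<psi> lines[OF L(1)] _ that] L(2) by blast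
    then have "L = {p}"
      using inj L(2) by (metis image_empty image_insert inj_image_eq_iff)
    then show ?thesis
      using L(1) stationary_of_singleton_integral_line by blast
  qed
  ultimately show ?thesis using that hk by blast
qed

lemma shear_eq_0_iff: "shear i j \<phi> p = 0 \<longleftrightarrow> \<phi> (rep_torus p $ j) = 0"
  by (simp add: shear_def axis_eq_0_iff)

text \<open>The cosine of the \<open>j\<close>-th coordinate takes three values on the zero set of the first field,
  whereas the zero set of the second one is a union of two connected sets.\<close>

lemma shear_not_topologically_equivalent:
  fixes i j :: "'n::finite"
  assumes ij: "i \<noteq> j" and \<phi>: "circle_fun \<phi>" and \<psi>: "circle_fun \<psi>" and q: "\<bar>q\<bar> < 1"
    and \<phi>0: "\<And>y. \<phi> y = 0 \<longleftrightarrow> sin y = 0 \<or> cos y = q"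
    and \<psi>0: "\<And>y. \<psi> y = 0 \<longleftrightarrow> sin y = 0"
  shows "\<not> topologically_equivalent (shear i j \<phi>) (shear i j \<psi>)"
proof
  assume eq: "topologically_equivalent (shear i j \<phi>) (shear i j \<psi>)"
  obtain h k where hk: "homeomorphism UNIV UNIV h k"
    and zeros: "\<And>p. shear i j \<phi> p = 0 \<longleftrightarrow> shear i j \<psi> (h p) = 0"
    using topologically_equivalent_shear_zeros[OF ij \<phi> \<psi> eq] by metis
  define C where "C p = cos (rep_torus p $ j)" for p :: "'n torus"
  have C: "C (to_torus x) = cos (x $ j)" for x
    using circle_fun_rep_to_torus[OF circle_fun_cos[of 1]] by (simp add: C_def)
  have C_cont: "continuous_on S C" for S
    by (rule continuous_on_subset[of UNIV])
       (auto simp: continuous_on_torus_iff C intro!: continuous_intros)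
  \<comment> \<open>Image of a hyperplane, connected by convexity; \<open>A 0\<close> and
    \<open>A pi\<close> cover the zero set of the second field.\<close>
  define A where "A a = to_torus ` {x :: real ^ 'n. x $ j = a}" for a
  have "connected (A a)" for a
    unfolding A_def
    by (intro connected_continuous_image continuous_on_to_torus convex_connected)
       (auto simp: convex_def simp flip: distrib_right)
  have zero_cover: "shear i j \<psi> p = 0 \<Longrightarrow> p \<in> A 0 \<union> A pi" for p
  proof -
    assume "shear i j \<psi> p = 0"
    then have "sin (rep_torus p $ j) = 0" by (simp add: shear_eq_0_iff \<psi>0)
    then obtain n :: int where n: "rep_torus p $ j = of_int n * pi"
      by (auto simp: sin_zero_iff_int2)
    \<comment> \<open>Removing whole periods leaves \<open>n mod 2\<close> times \<open>pi\<close>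
      as coordinate \<open>j\<close>.\<close>
    define x where "x = rep_torus p - (2 * pi * of_int (n div 2)) *\<^sub>R axis j 1"
    have "torus_rel (rep_torus p) x"
      by (auto simp: torus_rel_def x_def axis_def intro: exI[of _ "n div 2"] exI[of _ 0])
    then have p: "p = to_torus x" by (simp flip: to_torus_eq_iff)
    have "real_of_int n = 2 * of_int (n div 2) + of_int (n mod 2)"
      by (metis mult_div_mod_eq of_int_add of_int_mult of_int_numeral)
    then have "x $ j = of_int (n mod 2) * pi"
      by (simp add: x_def n axis_def algebra_simps)
    moreover have "n mod 2 = 0 \<or> n mod 2 = 1" by presburger
    ultimately have "x $ j = 0 \<or> x $ j = pi" by auto
    then show "p \<in> A 0 \<union> A pi" unfolding p A_def by auto
  qed
  \<comment> \<open>The inverse \<open>k\<close> carries \<open>A a\<close> into the first zero set,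
    where \<open>C\<close> takes finitely many values; a connected finite set of reals is a single
    point.\<close>
  have "\<exists>c. C ` k ` A a \<subseteq> {c}" if a: "sin a = 0" for a
  proof -
    have "C p \<in> {1, - 1, q}" if "p \<in> k ` A a" for p
    proof -
      obtain x where x: "x $ j = a" "p = k (to_torus x)"
        using \<open>p \<in> k ` A a\<close> by (auto simp: A_def)
      have "h p = to_torus x" using hk x by (simp add: homeomorphism_def)
      then have "shear i j \<psi> (h p) = 0"
        using a x \<psi>0 by (simp add: shear_to_torus \<psi>)
      then have "sin (rep_torus p $ j) = 0 \<or> C p = q"
        using zeros by (simp add: shear_eq_0_iff \<phi>0 C_def)
      then show ?thesis
        using sin_zero_abs_cos_one[of "rep_torus p $ j"] by (auto simp: C_def abs_if split: if_splits)
    qed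
    then have "C ` k ` A a \<subseteq> {1, - 1, q}" by blast
    then have "finite (C ` k ` A a)" by (rule finite_subset) simp
    moreover have "continuous_on (A a) k"
      using hk continuous_on_subset[of UNIV k "A a"] by (simp add: homeomorphism_def)
    then have "connected (C ` k ` A a)"
      using \<open>connected (A a)\<close> C_cont by (intro connected_continuous_image)
    ultimately show ?thesis
      by (auto simp: connected_finite_iff_sing)
  qed
  from this[of 0] this[of pi] obtain c d where cd: "C ` k ` A 0 \<subseteq> {c}" "C ` k ` A pi \<subseteq> {d}"
    by auto
  have "cos y \<in> {c, d}" if "\<phi> y = 0" for y
  proof -
    let ?p = "to_torus (\<chi> l. y) :: 'n torus"
    have "shear i j \<phi> ?p = 0" using that by (simp add: shear_to_torus \<phi>)
    then have "h ?p \<in> A 0 \<union> A pi" using zeros zero_cover by blast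
    moreover have "k (h ?p) = ?p" using hk by (simp add: homeomorphism_def)
    ultimately have "?p \<in> k ` A 0 \<union> k ` A pi" by (metis Un_iff image_eqI)
    then have "C ?p \<in> {c, d}" using cd by blast
    then show ?thesis using C[of "\<chi> l. y"] by simp
  qed
  \<comment> \<open>These zeros of \<open>\<phi>\<close> have the distinct cosines 1, -1 and
    \<open>q\<close>, while only the two values \<open>c\<close> and \<open>d\<close> are
    available.\<close>
  from this[of 0] this[of pi] this[of "arccos q"]
  have "{1, - 1, q} \<subseteq> {c, d}"
    using q by (simp add: \<phi>0 cos_arccos_abs)
  then show False
    using q by (auto simp: abs_less_iff)
qed

section \<open>A two-mode shear\<close>

definition two_mode :: "real \<Rightarrow> real \<Rightarrow> real \<Rightarrow> real" where
  "two_mode a c y = a * sin y + c * sin (2 * y)"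

lemma circle_fun_two_mode: "circle_fun (two_mode a c)"
  and circle_fun_two_mode_cos: "circle_fun (\<lambda>y. a * cos y + c * cos (2 * y))"
  using circle_fun_sin[of 1] circle_fun_sin[of 2] circle_fun_cos[of 1] circle_fun_cos[of 2]
  by (simp_all add: circle_fun_def two_mode_def)

lemma two_mode_deriv: "(two_mode a c has_real_derivative a * cos y + (2 * c) * cos (2 * y)) (at y)"
  and two_mode_cos_deriv:
    "((\<lambda>y. a * cos y + c * cos (2 * y)) has_real_derivative two_mode (- a) (- 2 * c) y) (at y)"
  unfolding two_mode_def by (auto intro!: derivative_eq_intros)

lemma global_smooth_two_mode:
  fixes i j :: "'n::finite"
  shows "global_smooth (\<lambda>t. shear i j (two_mode (a * exp (- \<alpha> * t)) (c * exp (- \<beta> * t))))"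
proof -
  have modes: "Ck_on k (\<lambda>z :: real \<times> (real ^ 'n). (exp (- \<alpha> * fst z) * sin (1 * snd z $ j + 0)) *\<^sub>R a *\<^sub>R axis i 1
      + (exp (- \<beta> * fst z) * sin (2 * snd z $ j + 0)) *\<^sub>R c *\<^sub>R axis i 1) S" for k S
    by (intro Ck_on_add Ck_on_decaying_mode)
  show ?thesis
    unfolding global_smooth_def smooth_on_def
    by (intro allI Ck_on_cong[OF modes])
       (auto simp: shear_to_torus circle_fun_two_mode two_mode_def algebra_simps)
qed

text \<open>The modes \<open>sin y\<close> and \<open>sin (2 * y)\<close> are eigenfunctions of the
  second derivative with eigenvalues -1 and -4, which dictates the decay rates \<open>\<eta>\<close>
  and \<open>4 * \<eta>\<close>.\<close>

lemma two_mode_MHD_solution: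
  fixes i j :: "'n::finite"
  assumes ij: "i \<noteq> j"
    and b_def: "b = (\<lambda>t. shear i j (two_mode (a * exp (- \<eta> * t)) (c * exp (- (4 * \<eta>) * t))))"
  shows "MHD_global_smooth_solution \<nu> \<eta> (\<lambda>_. 0) (b 0) (\<lambda>_ _. 0) b" "zero_average b"
proof -
  have zero: "partial k (\<lambda>_. 0 :: 'c::real_normed_vector) = (\<lambda>_. 0)" for k
    using partial_eqI[OF has_partial_const] by auto
  have zero_smooth: "global_smooth (\<lambda>_ _. 0 :: 'c::real_normed_vector)"
    by (simp add: global_smooth_def smooth_on_def Ck_on_const case_prod_unfold)
  have zero_time: "time_deriv (\<lambda>_ _. 0 :: 'c::real_normed_vector) t p = 0" if "t \<ge> 0" for t p
    using that by (intro time_deriv_eqI) auto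
  note [simp] = circle_fun_two_mode circle_fun_two_mode_cos
  have "time_deriv b t p = \<eta> *\<^sub>R laplacian (b t) p" if t: "t \<ge> 0" for t p
  proof -
    obtain x where p: "p = to_torus x" by (rule torus_cases)
    have "laplacian (b t) p = shear i j (two_mode (- (a * exp (- \<eta> * t))) (- 2 * (2 * (c * exp (- (4 * \<eta>) * t))))) p"
      unfolding b_def by (rule laplacian_shear[OF ij two_mode_deriv _ _ two_mode_cos_deriv]) auto
    then have lap: "laplacian (b t) p = (- (a * exp (- \<eta> * t) * sin (x $ j))
        - 4 * (c * exp (- (4 * \<eta>) * t) * sin (2 * x $ j))) *\<^sub>R axis i 1"
      by (simp add: p shear_to_torus two_mode_def)
    have "((\<lambda>s. b s p) has_vector_derivative
        (\<eta> * (- (a * exp (- \<eta> * t) * sin (x $ j))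
          - 4 * (c * exp (- (4 * \<eta>) * t) * sin (2 * x $ j)))) *\<^sub>R axis i 1) (at t within {0..})"
      unfolding b_def p shear_to_torus[OF circle_fun_two_mode] two_mode_def
      by (rule has_vector_derivative_scaleR[THEN has_vector_derivative_eq_rhs])
         (auto intro!: derivative_eq_intros simp: algebra_simps)
    then show ?thesis
      using t by (simp add: lap time_deriv_eqI)
  qed
  moreover have "divergence_free (b t)" for t
    unfolding b_def by (rule divergence_free_shear[OF ij two_mode_deriv]) auto
  moreover have "divergence_free (\<lambda>_. 0)"
    by (simp add: divergence_free_def divergence_def zero)
  moreover have "advect (b t) (b t) p = 0" for t p
    unfolding b_def by (rule advect_shear[OF ij two_mode_deriv]) auto
  moreover have "global_smooth b"
    unfolding b_def by (rule global_smooth_two_mode)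
  moreover have "\<exists>P :: real \<Rightarrow> 'n torus \<Rightarrow> real. global_smooth P \<and> (\<forall>t p. gradient (P t) p = 0)"
    by (intro exI[of _ "\<lambda>_ _. 0"]) (auto simp: zero_smooth gradient_def zero vec_eq_iff)
  ultimately show "MHD_global_smooth_solution \<nu> \<eta> (\<lambda>_. 0) (b 0) (\<lambda>_ _. 0) b"
    unfolding MHD_global_smooth_solution_def
    by (auto simp: zero_smooth zero_time advect_def[of "\<lambda>_. 0"] advect_def[of _ "\<lambda>_. 0"] laplacian_def[of "\<lambda>_. 0"] zero)
  show "zero_average b"
    unfolding zero_average_def b_def
  proof (intro allI impI)
    fix t :: real
    let ?a = "a * exp (- \<eta> * t)" and ?c = "c * exp (- (4 * \<eta>) * t)"
    \<comment> \<open>A periodic primitive of the profile, as needed for the vanishing of the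
      mean.\<close>
    have "((\<lambda>y. - ?a * cos y + (- ?c / 2) * cos (2 * y)) has_real_derivative two_mode ?a ?c y) (at y)" for y
      using two_mode_cos_deriv[of "- ?a" "- ?c / 2" y] by simp
    moreover have "continuous_on UNIV (two_mode ?a ?c)"
      unfolding two_mode_def by (intro continuous_intros)
    ultimately show "(\<integral>p. shear i j (two_mode ?a ?c) p \<partial>torus_measure) = 0"
      by (rule integral_shear_deriv[OF ij _ circle_fun_two_mode_cos circle_fun_two_mode])
  qed
qed

text \<open>The double-angle formula factors the profile. Zeros with \<open>sin y \<noteq> 0\<close>
  exist exactly when \<open>\<bar>r\<bar> > 1\<close>, so the ratio \<open>r\<close> of the modes
  controls the topology.\<close>

lemma two_mode_zero_iff:
  assumes "a \<noteq> 0"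
  shows "two_mode a (a * r / 2) y = 0 \<longleftrightarrow> sin y = 0 \<or> 1 + r * cos y = 0"
proof -
  have "two_mode a (a * r / 2) y = a * (sin y * (1 + r * cos y))"
    unfolding two_mode_def sin_double by (simp add: algebra_simps)
  then show ?thesis using assms by simp
qed

lemma L2_norm_torus_scaleR: "L2_norm_torus (\<lambda>p. r *\<^sub>R v p) = \<bar>r\<bar> * L2_norm_torus v"
  by (simp add: L2_norm_torus_def power_mult_distrib real_sqrt_mult)

lemma L2_norm_torus_pos:
  fixes v :: "'n::finite torus \<Rightarrow> real ^ 'n"
  assumes "continuous_on UNIV (\<lambda>x. v (to_torus x))" "v p \<noteq> 0"
  shows "0 < L2_norm_torus v"
proof -
  have cont: "continuous_on S (\<lambda>x. (norm (v (to_torus x)))\<^sup>2)" for S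
    by (intro continuous_intros continuous_on_subset[OF assms(1)]) auto
  obtain x where x: "x \<in> torus_cube" "p = to_torus x" by (rule to_torus_cube)
  have "integral torus_cube (\<lambda>x. (norm (v (to_torus x)))\<^sup>2) \<noteq> 0"
    using continuous_eq_0_of_integral_cube[OF cont _ _ x(1)] assms(2) x(2) by auto
  moreover have "0 \<le> integral torus_cube (\<lambda>x. (norm (v (to_torus x)))\<^sup>2)"
    by (intro integral_nonneg integrable_continuous cont) auto
  ultimately show ?thesis
    using cont by (simp add: L2_norm_torus_def integral_torus)
qed

theorem theorem1p1:
  fixes \<nu> \<eta> T M :: real
  assumes "CARD('n::finite) \<in> {2, 3}"
    and "\<nu> > 0" and "\<eta> > 0" and "T > 0" and "M > 0"
  shows "\<exists>b0 :: 'n torus \<Rightarrow> real ^ 'n.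
    divergence_free b0 \<and> L2_norm_torus b0 = M \<and>
    (\<exists>u b. MHD_global_smooth_solution \<nu> \<eta> (\<lambda>_. 0) b0 u b \<and>
       zero_average u \<and> zero_average b \<and>
       (\<forall>u' b'. MHD_global_smooth_solution \<nu> \<eta> (\<lambda>_. 0) b0 u' b' \<and>
            zero_average u' \<and> zero_average b' \<longrightarrow>
          (\<forall>t\<ge>0. u' t = u t \<and> b' t = b t)) \<and>
       \<not> topologically_equivalent (b 0) (b T))"
proof -
  have "2 \<le> CARD('n)" using assms(1) by auto
  then have "\<exists>i j :: 'n. i \<noteq> j"
    by (metis (full_types) card_2_iff' card_le_Suc0_iff_eq finite not_less_eq_eq numeral_2_eq_2 UNIV_I)
  then obtain i j :: 'n where ij: "i \<noteq> j" by blast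
  \<comment> \<open>Chosen so that \<open>q * q = exp (- (3 * \<eta> * T))\<close> is the decay of
    the second mode relative to the first up to time \<open>T\<close>: the ratio \<open>r\<close>
    falls from \<open>1 / q > 1\<close> to \<open>q < 1\<close>.\<close>
  define q where "q = exp (- (3 * \<eta> * T / 2))"
  have q: "0 < q" "q < 1" using assms by (auto simp: q_def)
  define v where "v = shear i j (two_mode 1 (1 / q / 2))"
  have "continuous_on UNIV (two_mode 1 (1 / q / 2))"
    unfolding two_mode_def by (intro continuous_intros)
  then have "continuous_on UNIV (\<lambda>x. v (to_torus x))"
    unfolding v_def by (intro continuous_on_shear circle_fun_two_mode)
  \<comment> \<open>At \<open>pi / 2\<close> the second mode vanishes and the first equals
    1.\<close>
  moreover have "v (to_torus (\<chi> l. pi / 2)) \<noteq> 0"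
    by (simp add: v_def shear_to_torus circle_fun_two_mode two_mode_def axis_eq_0_iff)
  ultimately have N: "0 < L2_norm_torus v" by (rule L2_norm_torus_pos)
  \<comment> \<open>Rescales the profile to norm \<open>M\<close>; both modes share the factor, so
    the zeros stay the same.\<close>
  define A where "A = M / L2_norm_torus v"
  have A: "0 < A" using N assms by (simp add: A_def)
  define b where
    "b = (\<lambda>t. shear i j (two_mode (A * exp (- \<eta> * t)) (A / (2 * q) * exp (- (4 * \<eta>) * t))))"
  note sol = two_mode_MHD_solution[OF ij b_def]
  have "b 0 = (\<lambda>p. A *\<^sub>R v p)"
    by (simp add: b_def v_def shear_def two_mode_def fun_eq_iff algebra_simps)
  then have "L2_norm_torus (b 0) = M"
    using N A assms(5) by (simp add: L2_norm_torus_scaleR A_def)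
  moreover have "zero_average (\<lambda>_ _. 0 :: real ^ 'n)"
    by (simp add: zero_average_def)
  moreover have "\<not> topologically_equivalent (b 0) (b T)"
    unfolding b_def
  proof (rule shear_not_topologically_equivalent[OF ij circle_fun_two_mode circle_fun_two_mode])
    \<comment> \<open>The extra initial zeros solve \<open>1 + cos y / q = 0\<close>, that is
      \<open>cos y = - q\<close>.\<close>
    show "\<bar>- q\<bar> < 1" using q by simp
    fix y
    show "two_mode (A * exp (- \<eta> * 0)) (A / (2 * q) * exp (- (4 * \<eta>) * 0)) y = 0
        \<longleftrightarrow> sin y = 0 \<or> cos y = - q"
      using two_mode_zero_iff[of A "1 / q" y] A q by (simp add: field_simps add_eq_0_iff)
    have "exp (- (4 * \<eta>) * T) = q * q * exp (- \<eta> * T)"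
      by (simp add: q_def field_simps flip: exp_add)
    then have coeff: "A / (2 * q) * exp (- (4 * \<eta>) * T) = (A * exp (- \<eta> * T)) * q / 2"
      using q by simp
    \<comment> \<open>At time \<open>T\<close> the second factor is \<open>1 + q * cos y\<close>,
      which has no zeros because \<open>q < 1\<close>.\<close>
    have "q * \<bar>cos y\<bar> \<le> q * 1"
      using q by (intro mult_left_mono) auto
    then have "\<bar>q * cos y\<bar> < 1"
      using q(2) unfolding abs_mult abs_of_pos[OF q(1)] by linarith
    then have "1 + q * cos y \<noteq> 0" by (auto simp: abs_less_iff)
    then show "two_mode (A * exp (- \<eta> * T)) (A / (2 * q) * exp (- (4 * \<eta>) * T)) y = 0
        \<longleftrightarrow> sin y = 0"
      unfolding coeff using two_mode_zero_iff[of "A * exp (- \<eta> * T)" q y] A by simp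
  qed
  moreover have "divergence_free (b 0)"
    using sol(1)[of \<nu>] by (simp add: MHD_global_smooth_solution_def)
  moreover have "u' t = (\<lambda>_. 0) \<and> b' t = b t"
    if "MHD_global_smooth_solution \<nu> \<eta> (\<lambda>_. 0) (b 0) u' b'" "t \<ge> 0" for u' b' t
    using MHD_unique[OF sol(1) that(1) _ _ that(2)] assms by simp
  ultimately show ?thesis
    using sol(1)[of \<nu>] sol(2) by (intro exI[of _ "b 0"] exI[of _ "\<lambda>_ _. 0"] exI[of _ b]) blast
qed

end
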